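(* Let $D$ be a defeasible theory and $q$ a ground literal of $D$ (written $p(\vec a)$ or $\neg p(\vec a)$ in $D$, and represented by the term $\mathtt{p}(\vec a)$ or $\mathtt{not\_p}(\vec a)$ in the metaprograms). Then $D\vdash+\partial_{||}q$ iff $\mathcal M_{\partial_{||}}(D)\models_{WF}\mathtt{defeasibly}(q)$, and $D\vdash+\partial^*_{||}q$ iff $\mathcal M_{\partial^*_{||}}(D)\models_{WF}\mathtt{defeasibly}(q)$.
   Context: Defeasible theories. Terms are built from variables, constants and function symbols. A literal is an atom $p(t_1,\dots,t_n)$ or its classical negation $\neg p(t_1,\dots,t_n)$; ${\sim}q$ denotes the complementary literal. A defeasible theory is a triple $D=(F,R,>)$: $F$ a finite set of variable-free literals (facts); $R$ a finite set of rules, each with a distinct label $r$, a finite antecedent set of literals $A(r)$, a consequent literal $C(r)$, and a kind: strict ($\to$), defeasible ($\Rightarrow$) or defeater ($\leadsto$); $>$ an acyclic binary relation on rule labels. $R_s$: strict rules; $R_{sd}$: strict or defeasible rules; $R[q]$: rules with consequent $q$. A non-ground theory is identified with the set of ground instances of its rules. $P_\Delta$ is the least set of ground literals with $q\in P_\Delta$ whenever $q\in F$ or some $r\in R_s[q]$ has $A(r)\subseteq P_\Delta$. $P_\lambda$ is the least set with $q\in P_\lambda$ whenever $q\in P_\Delta$, or some $r\in R_{sd}[q]$ has $A(r)\subseteq P_\lambda$ and ${\sim}q\notin P_\Delta$. $P_{\partial_{||}}$ is the least set $X$ with $q\in X$ whenever $q\in P_\Delta$, or (2.1) some $r\in R_{sd}[q]$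 has $A(r)\subseteq X$, (2.2) ${\sim}q\notin P_\Delta$, and (2.3) for every $s\in R[{\sim}q]$ either some $\alpha\in A(s)$ has $\alpha\notin P_\lambda$, or some $t\in R_{sd}[q]$ has $A(t)\subseteq X$ and $t>s$. $P_{\partial^*_{||}}$ is defined identically except that the second alternative of (2.3) is replaced by "$r>s$" with $r$ the rule from (2.1). $D\vdash+\partial_{||}q$ means $q\in P_{\partial_{||}}$ and $D\vdash+\partial^*_{||}q$ means $q\in P_{\partial^*_{||}}$. Metaprograms. $D$ is represented by unit clauses: $\mathtt{fact}(q)$ for $q\in F$; $\mathtt{strict}(r,q,[q_1,\dots,q_n])$, $\mathtt{defeasible}(r,q,[q_1,\dots,q_n])$, $\mathtt{defeater}(r,q,[q_1,\dots,q_n])$ for each rule $r:q_1,\dots,q_n\hookrightarrow q$ of the respective kind; $\mathtt{sup}(r,s)$ for each $r>s$; here predicates of $D$ become function symbols and $\neg p(\vec t)$ is written $\mathtt{not\_p}(\vec t)$; also for each predicate $p$ of $D$ the unit clauses $\mathtt{neg}(\mathtt{p}(\vec X),\mathtt{not\_p}(\vec X))$ and $\mathtt{neg}(\mathtt{not\_p}(\vec X),\mathtt{p}(\vec X))$. $\mathcal M_{\partial_{||}}(D)$ is this representation together with the clauses: $\mathtt{rule}(R,H,B)\,\text{:-}\,\mathtt{strict\_or\_defeasible}(R,H,B)$; $\mathtt{rule}(R,H,B)\,\text{:-}\,\mathtt{defeater}(R,H,B)$; $\mathtt{strict\_or\_defeasible}(R,H,B)\,\text{:-}\,\mathtt{strict}(R,H,B)$;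 $\mathtt{strict\_or\_defeasible}(R,H,B)\,\text{:-}\,\mathtt{defeasible}(R,H,B)$; for $\tau\in\{\mathtt{definitely},\mathtt{lambda},\mathtt{defeasibly}\}$: $\mathtt{loop\_}\tau([\,])$ and $\mathtt{loop\_}\tau([H|T])\,\text{:-}\,\tau(H),\mathtt{loop\_}\tau(T)$; $\mathtt{definitely}(X)\,\text{:-}\,\mathtt{fact}(X)$; $\mathtt{definitely}(X)\,\text{:-}\,\mathtt{strict}(R,X,Y),\mathtt{loop\_definitely}(Y)$; $\mathtt{lambda}(X)\,\text{:-}\,\mathtt{definitely}(X)$; $\mathtt{lambda}(X)\,\text{:-}\,\mathtt{neg}(X,X'),\ not\ \mathtt{definitely}(X'),\ \mathtt{strict\_or\_defeasible}(R,X,Y),\ \mathtt{loop\_lambda}(Y)$; $\mathtt{defeasibly}(X)\,\text{:-}\,\mathtt{definitely}(X)$; $\mathtt{defeasibly}(X)\,\text{:-}\,\mathtt{neg}(X,X'),\ not\ \mathtt{definitely}(X'),\ \mathtt{strict\_or\_defeasible}(R,X,Y),\ \mathtt{loop\_defeasibly}(Y),\ not\ \mathtt{overruled}(X)$; $\mathtt{overruled}(X)\,\text{:-}\,\mathtt{neg}(X,X'),\ \mathtt{rule}(S,X',U),\ \mathtt{loop\_lambda}(U),\ not\ \mathtt{defeated}(S,X')$; $\mathtt{defeated}(S,X')\,\text{:-}\,\mathtt{neg}(X,X'),\ \mathtt{sup}(T,S),\ \mathtt{strict\_or\_defeasible}(T,X,V),\ \mathtt{loop\_defeasibly}(V)$.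 $\mathcal M_{\partial^*_{||}}(D)$ is identical except that its last three clauses are replaced by: $\mathtt{defeasibly}(X)\,\text{:-}\,\mathtt{neg}(X,X'),\ not\ \mathtt{definitely}(X'),\ \mathtt{strict\_or\_defeasible}(R,X,Y),\ \mathtt{loop\_defeasibly}(Y),\ not\ \mathtt{overruled}(R,X)$; $\mathtt{overruled}(R,X)\,\text{:-}\,\mathtt{neg}(X,X'),\ \mathtt{rule}(S,X',U),\ \mathtt{loop\_lambda}(U),\ not\ \mathtt{defeats}(R,S)$; $\mathtt{defeats}(R,S)\,\text{:-}\,\mathtt{sup}(R,S)$. $P\models_{WF}\ell$ means that the ground literal $\ell$ holds in the well-founded model of the logic program $P$. *)

theory Defs
  imports Main
begin

section \<open>First-order syntax\<close>

datatype (fun_syms: 'f, vars_trm: 'v) trm = Var 'v | Fun 'f "('f, 'v) trm list"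

datatype (pred_syms: 'p, atom_fun_syms: 'f, vars_atom: 'v) atom =
  Atom 'p "('f, 'v) trm list"

datatype 'a literal = Pos 'a | Neg 'a

primrec complement :: "'a literal \<Rightarrow> 'a literal" where
  "complement (Pos a) = Neg a"
| "complement (Neg a) = Pos a"

primrec atom_of :: "'a literal \<Rightarrow> 'a" where
  "atom_of (Pos a) = a"
| "atom_of (Neg a) = a"

text \<open>A signature is a set of function symbols with arities; constants have arity 0.\<close>

fun wf_trm :: "('f \<times> nat) set \<Rightarrow> ('f, 'v) trm \<Rightarrow> bool" where
  "wf_trm \<Sigma> (Var x) = True"
| "wf_trm \<Sigma> (Fun f ts) = ((f, length ts) \<in> \<Sigma> \<and> (\<forall>t\<in>set ts. wf_trm \<Sigma> t))"

definition ground_terms :: "('f \<times> nat) set \<Rightarrow> ('f, 'v) trm set" where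
  "ground_terms \<Sigma> = {t. wf_trm \<Sigma> t \<and> vars_trm t = {}}"

primrec args :: "('p, 'f, 'v) atom \<Rightarrow> ('f, 'v) trm list" where
  "args (Atom p ts) = ts"

primrec pred_of :: "('p, 'f, 'v) atom \<Rightarrow> 'p \<times> nat" where
  "pred_of (Atom p ts) = (p, length ts)"

fun subst_trm :: "('v \<Rightarrow> ('f, 'w) trm) \<Rightarrow> ('f, 'v) trm \<Rightarrow> ('f, 'w) trm" where
  "subst_trm \<sigma> (Var x) = \<sigma> x"
| "subst_trm \<sigma> (Fun f ts) = Fun f (map (subst_trm \<sigma>) ts)"

primrec subst_atom :: "('v \<Rightarrow> ('f, 'w) trm) \<Rightarrow> ('p, 'f, 'v) atom \<Rightarrow> ('p, 'f, 'w) atom" where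
  "subst_atom \<sigma> (Atom p ts) = Atom p (map (subst_trm \<sigma>) ts)"


section \<open>Normal logic programs and the well-founded semantics\<close>

datatype 'a clause = Clause (head: 'a) (body: "'a literal list") (infix ":-" 50)

definition vars_clause :: "('p, 'f, 'v) atom clause \<Rightarrow> 'v set" where
  "vars_clause c = \<Union> (vars_atom ` set_clause c)"

text \<open>The Herbrand instances of a program. Variables are sorted: \<open>U x\<close> is the set of ground terms
  over which the variable \<open>x\<close> ranges. In a one-sorted program, \<open>U\<close> is constantly
  the Herbrand universe.\<close>

definition ground_clauses ::
  "('v \<Rightarrow> ('f, 'v) trm set) \<Rightarrow> ('p, 'f, 'v) atom clause set \<Rightarrow> ('p, 'f, 'v) atom clause set" where
  "ground_clauses U P =
     {map_clause (subst_atom \<sigma>) c | \<sigma> c. c \<in> P \<and> (\<forall>x\<in>vars_clause c. \<sigma> x \<in> U x)}"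

text \<open>The well-founded model as defined by Van Gelder, Ross and Schlipf. A partial
  interpretation is a set of ground literals. The type \<open>'a\<close> of atoms plays the role of the
  Herbrand base; atoms that are not the head of any clause are unfounded.\<close>

definition unfounded :: "'a clause set \<Rightarrow> 'a literal set \<Rightarrow> 'a set \<Rightarrow> bool" where
  "unfounded P I A \<longleftrightarrow>
     (\<forall>c\<in>P. head c \<in> A \<longrightarrow>
        (\<exists>l\<in>set (body c). complement l \<in> I) \<or> (\<exists>a\<in>A. Pos a \<in> set (body c)))"

definition greatest_unfounded :: "'a clause set \<Rightarrow> 'a literal set \<Rightarrow> 'a set" where
  "greatest_unfounded P I = \<Union> {A. unfounded P I A}"

definition immediate_consequences :: "'a clause set \<Rightarrow> 'a literal set \<Rightarrow> 'a set" where
  "immediate_consequences P I = {head c | c. c \<in> P \<and> set (body c) \<subseteq> I}"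

definition wf_operator :: "'a clause set \<Rightarrow> 'a literal set \<Rightarrow> 'a literal set" where
  "wf_operator P I = Pos ` immediate_consequences P I \<union> Neg ` greatest_unfounded P I"

lemma mono_wf_operator: "mono (wf_operator P)"
proof (rule monoI)
  fix I J :: "'a literal set"
  assume "I \<subseteq> J"
  then have "immediate_consequences P I \<subseteq> immediate_consequences P J"
    by (auto simp: immediate_consequences_def)
  moreover have "unfounded P J A" if "unfounded P I A" for A
    using that \<open>I \<subseteq> J\<close> unfolding unfounded_def by (meson subsetD)
  then have "greatest_unfounded P I \<subseteq> greatest_unfounded P J"
    by (auto simp: greatest_unfounded_def)
  ultimately show "wf_operator P I \<subseteq> wf_operator P J"
    by (auto simp: wf_operator_def)
qed

definition wf_model :: "'a clause set \<Rightarrow> 'a literal set" where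
  "wf_model P = lfp (wf_operator P)"

definition wf_entails ::
  "('v \<Rightarrow> ('f, 'v) trm set) \<Rightarrow> ('p, 'f, 'v) atom clause set \<Rightarrow> ('p, 'f, 'v) atom literal \<Rightarrow> bool" where
  "wf_entails U P l \<longleftrightarrow> l \<in> wf_model (ground_clauses U P)"


section \<open>Defeasible theories\<close>

datatype rule_kind = Strict | Defeasible | Defeater

text \<open>The antecedent set of a rule is given by a list, which also fixes the order in which
  its elements are written in the metaprogram.\<close>

record ('p, 'f, 'v, 'l) rule =
  label :: 'l
  kind :: rule_kind
  ante :: "('p, 'f, 'v) atom literal list"
  concl :: "('p, 'f, 'v) atom literal"

record ('p, 'f, 'v, 'l) dtheory =
  facts :: "('p, 'f, 'v) atom literal set"
  rules :: "('p, 'f, 'v, 'l) rule set"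
  superior :: "('l \<times> 'l) set"

definition antecedent :: "('p, 'f, 'v, 'l) rule \<Rightarrow> ('p, 'f, 'v) atom literal set" where
  "antecedent r = set (ante r)"

definition literals_of_rule :: "('p, 'f, 'v, 'l) rule \<Rightarrow> ('p, 'f, 'v) atom literal set" where
  "literals_of_rule r = insert (concl r) (antecedent r)"

definition vars_rule :: "('p, 'f, 'v, 'l) rule \<Rightarrow> 'v set" where
  "vars_rule r = (\<Union>l\<in>literals_of_rule r. vars_atom (atom_of l))"

definition literals_of_theory :: "('p, 'f, 'v, 'l) dtheory \<Rightarrow> ('p, 'f, 'v) atom literal set" where
  "literals_of_theory D = facts D \<union> (\<Union>r\<in>rules D. literals_of_rule r)"

definition predicates_of :: "('p, 'f, 'v, 'l) dtheory \<Rightarrow> ('p \<times> nat) set" where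
  "predicates_of D = (\<lambda>l. pred_of (atom_of l)) ` literals_of_theory D"

text \<open>\<open>\<Sigma>\<close> is the signature of the language in which \<open>D\<close> is formulated; it may be larger
  than the set of function symbols that occur in \<open>D\<close>.\<close>

definition defeasible_theory :: "('f \<times> nat) set \<Rightarrow> ('p, 'f, 'v, 'l) dtheory \<Rightarrow> bool" where
  "defeasible_theory \<Sigma> D \<longleftrightarrow>
     finite (facts D) \<and> finite (rules D) \<and>
     (\<forall>l\<in>facts D. vars_atom (atom_of l) = {}) \<and>
     (\<forall>l\<in>literals_of_theory D. \<forall>t\<in>set (args (atom_of l)). wf_trm \<Sigma> t) \<and>
     inj_on label (rules D) \<and>
     superior D \<subseteq> label ` rules D \<times> label ` rules D \<and>
     acyclic (superior D)"

definition ground_literals ::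
  "('f \<times> nat) set \<Rightarrow> ('p, 'f, 'v, 'l) dtheory \<Rightarrow> ('p, 'f, 'v) atom literal set" where
  "ground_literals \<Sigma> D =
     {l. pred_of (atom_of l) \<in> predicates_of D \<and> set (args (atom_of l)) \<subseteq> ground_terms \<Sigma>}"

text \<open>Instances of a rule keep its label, so the superiority relation carries over to them.\<close>

definition subst_rule ::
  "('v \<Rightarrow> ('f, 'v) trm) \<Rightarrow> ('p, 'f, 'v, 'l) rule \<Rightarrow> ('p, 'f, 'v, 'l) rule" where
  "subst_rule \<sigma> r =
     \<lparr>label = label r, kind = kind r,
      ante = map (map_literal (subst_atom \<sigma>)) (ante r),
      concl = map_literal (subst_atom \<sigma>) (concl r)\<rparr>"

definition ground_rules ::
  "('f \<times> nat) set \<Rightarrow> ('p, 'f, 'v, 'l) dtheory \<Rightarrow> ('p, 'f, 'v, 'l) rule set" where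
  "ground_rules \<Sigma> D =
     {subst_rule \<sigma> r | \<sigma> r. r \<in> rules D \<and> (\<forall>x\<in>vars_rule r. \<sigma> x \<in> ground_terms \<Sigma>)}"

definition R_for ::
  "('f \<times> nat) set \<Rightarrow> ('p, 'f, 'v, 'l) dtheory \<Rightarrow> ('p, 'f, 'v) atom literal \<Rightarrow>
   ('p, 'f, 'v, 'l) rule set" where
  "R_for \<Sigma> D q = {r \<in> ground_rules \<Sigma> D. concl r = q}"

definition Rs_for ::
  "('f \<times> nat) set \<Rightarrow> ('p, 'f, 'v, 'l) dtheory \<Rightarrow> ('p, 'f, 'v) atom literal \<Rightarrow>
   ('p, 'f, 'v, 'l) rule set" where
  "Rs_for \<Sigma> D q = {r \<in> R_for \<Sigma> D q. kind r = Strict}"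

definition Rsd_for ::
  "('f \<times> nat) set \<Rightarrow> ('p, 'f, 'v, 'l) dtheory \<Rightarrow> ('p, 'f, 'v) atom literal \<Rightarrow>
   ('p, 'f, 'v, 'l) rule set" where
  "Rsd_for \<Sigma> D q = {r \<in> R_for \<Sigma> D q. kind r = Strict \<or> kind r = Defeasible}"

inductive_set P_Delta ::
  "('f \<times> nat) set \<Rightarrow> ('p, 'f, 'v, 'l) dtheory \<Rightarrow> ('p, 'f, 'v) atom literal set"
  for \<Sigma> D where
  "q \<in> facts D \<Longrightarrow> q \<in> P_Delta \<Sigma> D"
| "r \<in> Rs_for \<Sigma> D q \<Longrightarrow> \<forall>a\<in>antecedent r. a \<in> P_Delta \<Sigma> D \<Longrightarrow> q \<in> P_Delta \<Sigma> D"

inductive_set P_lambda ::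
  "('f \<times> nat) set \<Rightarrow> ('p, 'f, 'v, 'l) dtheory \<Rightarrow> ('p, 'f, 'v) atom literal set"
  for \<Sigma> D where
  "q \<in> P_Delta \<Sigma> D \<Longrightarrow> q \<in> P_lambda \<Sigma> D"
| "r \<in> Rsd_for \<Sigma> D q \<Longrightarrow> \<forall>a\<in>antecedent r. a \<in> P_lambda \<Sigma> D \<Longrightarrow>
   complement q \<notin> P_Delta \<Sigma> D \<Longrightarrow> q \<in> P_lambda \<Sigma> D"

inductive_set P_par ::
  "('f \<times> nat) set \<Rightarrow> ('p, 'f, 'v, 'l) dtheory \<Rightarrow> ('p, 'f, 'v) atom literal set"
  for \<Sigma> D where
  "q \<in> P_Delta \<Sigma> D \<Longrightarrow> q \<in> P_par \<Sigma> D"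
| "r \<in> Rsd_for \<Sigma> D q \<Longrightarrow> \<forall>a\<in>antecedent r. a \<in> P_par \<Sigma> D \<Longrightarrow>
   complement q \<notin> P_Delta \<Sigma> D \<Longrightarrow>
   \<forall>s\<in>R_for \<Sigma> D (complement q).
     (\<exists>a\<in>antecedent s. a \<notin> P_lambda \<Sigma> D) \<or>
     (\<exists>t\<in>Rsd_for \<Sigma> D q. (\<forall>a\<in>antecedent t. a \<in> P_par \<Sigma> D) \<and> (label t, label s) \<in> superior D) \<Longrightarrow>
   q \<in> P_par \<Sigma> D"

inductive_set P_par_star ::
  "('f \<times> nat) set \<Rightarrow> ('p, 'f, 'v, 'l) dtheory \<Rightarrow> ('p, 'f, 'v) atom literal set"
  for \<Sigma> D where
  "q \<in> P_Delta \<Sigma> D \<Longrightarrow> q \<in> P_par_star \<Sigma> D"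
| "r \<in> Rsd_for \<Sigma> D q \<Longrightarrow> \<forall>a\<in>antecedent r. a \<in> P_par_star \<Sigma> D \<Longrightarrow>
   complement q \<notin> P_Delta \<Sigma> D \<Longrightarrow>
   \<forall>s\<in>R_for \<Sigma> D (complement q).
     (\<exists>a\<in>antecedent s. a \<notin> P_lambda \<Sigma> D) \<or> (label r, label s) \<in> superior D \<Longrightarrow>
   q \<in> P_par_star \<Sigma> D"

definition proves_par ::
  "('f \<times> nat) set \<Rightarrow> ('p, 'f, 'v, 'l) dtheory \<Rightarrow> ('p, 'f, 'v) atom literal \<Rightarrow> bool" where
  "proves_par \<Sigma> D q \<longleftrightarrow> q \<in> P_par \<Sigma> D"

definition proves_par_star ::
  "('f \<times> nat) set \<Rightarrow> ('p, 'f, 'v, 'l) dtheory \<Rightarrow> ('p, 'f, 'v) atom literal \<Rightarrow> bool" where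
  "proves_par_star \<Sigma> D q \<longleftrightarrow> q \<in> P_par_star \<Sigma> D"


section \<open>Metaprograms\<close>

text \<open>\<open>PredSym p\<close> and \<open>NotPredSym p\<close> are the function symbols written \<open>p\<close> and \<open>not_p\<close>.\<close>

datatype ('p, 'f, 'l) msym =
  FunSym 'f | PredSym 'p | NotPredSym 'p | LabelSym 'l | NilSym | ConsSym

text \<open>\<open>ObjVar\<close> are the variables of the rules of the defeasible theory, and \<open>ArgVar 0\<close>,
  \<open>ArgVar 1\<close>, ... are the argument variables in the clauses for \<open>neg\<close>.\<close>

datatype 'v mvar =
  ObjVar 'v | ArgVar nat | VR | VH | VB | VT | VX | VX' | VY | VS | VU | VV

datatype mpred =
  m_fact | m_strict | m_defeasible | m_defeater | m_sup | m_neg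
| m_rule | m_strict_or_defeasible
| m_definitely | m_lambda | m_defeasibly
| m_loop_definitely | m_loop_lambda | m_loop_defeasibly
| m_overruled | m_defeated | m_defeats

type_synonym ('p, 'f, 'v, 'l) mtrm = "(('p, 'f, 'l) msym, 'v mvar) trm"
type_synonym ('p, 'f, 'v, 'l) matom = "(mpred, ('p, 'f, 'l) msym, 'v mvar) atom"

definition mnil :: "('p, 'f, 'v, 'l) mtrm" where
  "mnil = Fun NilSym []"

definition mcons :: "('p, 'f, 'v, 'l) mtrm \<Rightarrow> ('p, 'f, 'v, 'l) mtrm \<Rightarrow> ('p, 'f, 'v, 'l) mtrm" where
  "mcons t u = Fun ConsSym [t, u]"

definition mlist :: "('p, 'f, 'v, 'l) mtrm list \<Rightarrow> ('p, 'f, 'v, 'l) mtrm" where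
  "mlist ts = foldr mcons ts mnil"

definition rep_trm :: "('f, 'v) trm \<Rightarrow> ('p, 'f, 'v, 'l) mtrm" where
  "rep_trm = map_trm FunSym ObjVar"

fun rep_lit :: "('p, 'f, 'v) atom literal \<Rightarrow> ('p, 'f, 'v, 'l) mtrm" where
  "rep_lit (Pos (Atom p ts)) = Fun (PredSym p) (map rep_trm ts)"
| "rep_lit (Neg (Atom p ts)) = Fun (NotPredSym p) (map rep_trm ts)"

definition rep_label :: "'l \<Rightarrow> ('p, 'f, 'v, 'l) mtrm" where
  "rep_label r = Fun (LabelSym r) []"

primrec kind_pred :: "rule_kind \<Rightarrow> mpred" where
  "kind_pred Strict = m_strict"
| "kind_pred Defeasible = m_defeasible"
| "kind_pred Defeater = m_defeater"

definition rep_rule :: "('p, 'f, 'v, 'l) rule \<Rightarrow> ('p, 'f, 'v, 'l) matom" where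
  "rep_rule r = Atom (kind_pred (kind r))
     [rep_label (label r), rep_lit (concl r), mlist (map rep_lit (ante r))]"

definition neg_clauses :: "'p \<times> nat \<Rightarrow> ('p, 'f, 'v, 'l) matom clause set" where
  "neg_clauses pn =
     (let xs = map (\<lambda>i. Var (ArgVar i)) [0..<snd pn];
          pos = Fun (PredSym (fst pn)) xs;
          neg = Fun (NotPredSym (fst pn)) xs
      in {Atom m_neg [pos, neg] :- [], Atom m_neg [neg, pos] :- []})"

definition representation ::
  "('p, 'f, 'v, 'l) dtheory \<Rightarrow> ('p, 'f, 'v, 'l) matom clause set" where
  "representation D =
     {Atom m_fact [rep_lit q] :- [] | q. q \<in> facts D} \<union>
     {rep_rule r :- [] | r. r \<in> rules D} \<union>
     {Atom m_sup [rep_label r, rep_label s] :- [] | r s. (r, s) \<in> superior D} \<union>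
     (\<Union>pn\<in>predicates_of D. neg_clauses pn)"

definition loop_clauses :: "mpred \<Rightarrow> mpred \<Rightarrow> ('p, 'f, 'v, 'l) matom clause set" where
  "loop_clauses loop_tau tau =
     {Atom loop_tau [mnil] :- [],
      Atom loop_tau [mcons (Var VH) (Var VT)] :-
        [Pos (Atom tau [Var VH]), Pos (Atom loop_tau [Var VT])]}"

definition common_clauses :: "('p, 'f, 'v, 'l) matom clause set" where
  "common_clauses =
     {Atom m_rule [Var VR, Var VH, Var VB] :-
        [Pos (Atom m_strict_or_defeasible [Var VR, Var VH, Var VB])],
      Atom m_rule [Var VR, Var VH, Var VB] :-
        [Pos (Atom m_defeater [Var VR, Var VH, Var VB])],
      Atom m_strict_or_defeasible [Var VR, Var VH, Var VB] :-
        [Pos (Atom m_strict [Var VR, Var VH, Var VB])],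
      Atom m_strict_or_defeasible [Var VR, Var VH, Var VB] :-
        [Pos (Atom m_defeasible [Var VR, Var VH, Var VB])]} \<union>
     loop_clauses m_loop_definitely m_definitely \<union>
     loop_clauses m_loop_lambda m_lambda \<union>
     loop_clauses m_loop_defeasibly m_defeasibly \<union>
     {Atom m_definitely [Var VX] :- [Pos (Atom m_fact [Var VX])],
      Atom m_definitely [Var VX] :-
        [Pos (Atom m_strict [Var VR, Var VX, Var VY]),
         Pos (Atom m_loop_definitely [Var VY])],
      Atom m_lambda [Var VX] :- [Pos (Atom m_definitely [Var VX])],
      Atom m_lambda [Var VX] :-
        [Pos (Atom m_neg [Var VX, Var VX']),
         Neg (Atom m_definitely [Var VX']),
         Pos (Atom m_strict_or_defeasible [Var VR, Var VX, Var VY]),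
         Pos (Atom m_loop_lambda [Var VY])],
      Atom m_defeasibly [Var VX] :- [Pos (Atom m_definitely [Var VX])]}"

definition metaprogram_par ::
  "('p, 'f, 'v, 'l) dtheory \<Rightarrow> ('p, 'f, 'v, 'l) matom clause set" where
  "metaprogram_par D =
     representation D \<union> common_clauses \<union>
     {Atom m_defeasibly [Var VX] :-
        [Pos (Atom m_neg [Var VX, Var VX']),
         Neg (Atom m_definitely [Var VX']),
         Pos (Atom m_strict_or_defeasible [Var VR, Var VX, Var VY]),
         Pos (Atom m_loop_defeasibly [Var VY]),
         Neg (Atom m_overruled [Var VX])],
      Atom m_overruled [Var VX] :-
        [Pos (Atom m_neg [Var VX, Var VX']),
         Pos (Atom m_rule [Var VS, Var VX', Var VU]),
         Pos (Atom m_loop_lambda [Var VU]),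
         Neg (Atom m_defeated [Var VS, Var VX'])],
      Atom m_defeated [Var VS, Var VX'] :-
        [Pos (Atom m_neg [Var VX, Var VX']),
         Pos (Atom m_sup [Var VT, Var VS]),
         Pos (Atom m_strict_or_defeasible [Var VT, Var VX, Var VV]),
         Pos (Atom m_loop_defeasibly [Var VV])]}"

definition metaprogram_par_star ::
  "('p, 'f, 'v, 'l) dtheory \<Rightarrow> ('p, 'f, 'v, 'l) matom clause set" where
  "metaprogram_par_star D =
     representation D \<union> common_clauses \<union>
     {Atom m_defeasibly [Var VX] :-
        [Pos (Atom m_neg [Var VX, Var VX']),
         Neg (Atom m_definitely [Var VX']),
         Pos (Atom m_strict_or_defeasible [Var VR, Var VX, Var VY]),
         Pos (Atom m_loop_defeasibly [Var VY]),
         Neg (Atom m_overruled [Var VR, Var VX])],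
      Atom m_overruled [Var VR, Var VX] :-
        [Pos (Atom m_neg [Var VX, Var VX']),
         Pos (Atom m_rule [Var VS, Var VX', Var VU]),
         Pos (Atom m_loop_lambda [Var VU]),
         Neg (Atom m_defeats [Var VR, Var VS])],
      Atom m_defeats [Var VR, Var VS] :- [Pos (Atom m_sup [Var VR, Var VS])]}"

definition meta_signature ::
  "('f \<times> nat) set \<Rightarrow> ('p, 'f, 'v, 'l) dtheory \<Rightarrow> (('p, 'f, 'l) msym \<times> nat) set" where
  "meta_signature \<Sigma> D =
     {(FunSym f, n) | f n. (f, n) \<in> \<Sigma>} \<union>
     {(PredSym p, n) | p n. (p, n) \<in> predicates_of D} \<union>
     {(NotPredSym p, n) | p n. (p, n) \<in> predicates_of D} \<union>
     {(LabelSym (label r), 0) | r. r \<in> rules D} \<union>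
     {(NilSym, 0), (ConsSym, 2)}"

text \<open>The variables of the rules of \<open>D\<close> range over the ground terms of the language of \<open>D\<close>, as they
  do when \<open>D\<close> is identified with its set of ground instances; all other variables range over
  the whole Herbrand universe of the metaprogram. Letting the former range over labels, lists
  and literals as well would change the conclusions: with constant \<open>a\<close>, consider the rules
  \<open>\<Rightarrow> p(X)\<close> and \<open>p(X) \<Rightarrow> q\<close> together with the defeater \<open>\<leadsto> \<not>p(a)\<close>.\<close>

definition meta_universe ::
  "('f \<times> nat) set \<Rightarrow> ('p, 'f, 'v, 'l) dtheory \<Rightarrow> 'v mvar \<Rightarrow> ('p, 'f, 'v, 'l) mtrm set" where
  "meta_universe \<Sigma> D x =
     (case x of
        ObjVar y \<Rightarrow> rep_trm ` ground_terms \<Sigma>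
      | _ \<Rightarrow> ground_terms (meta_signature \<Sigma> D))"

end

theory Submission
  imports Defs
begin

text \<open>On the atoms that do not depend on \<open>defeasibly\<close>, the metaprograms are stratified, so
  that the well-founded model is total there and decides \<open>definitely\<close> and \<open>lambda\<close> by
  membership in \<open>P_Delta\<close> and \<open>P_lambda\<close>. Above this level the program for
  \<open>P_par\<close> has a loop through two negations (\<open>defeasibly\<close>, \<open>overruled\<close>,
  \<open>defeated\<close>) and its model is in general partial, but only one truth value of each
  predicate matters: \<open>defeasibly\<close> and \<open>defeated\<close> being true and \<open>overruled\<close> being
  false. By induction on \<open>P_par\<close>, every derived literal becomes true, since
  each clause for \<open>overruled\<close> fails once the superior rules apply, so that the singleton of this
  atom is unfounded. Conversely, the well-founded iteration only adds literals that
  are sound for \<open>P_par\<close>: an attacker whose body is in \<open>P_lambda\<close> gives an instance of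
  the clause for \<open>overruled\<close> whose positive body is true, hence outside every unfounded
  set, so that a false \<open>overruled\<close> must come from a true \<open>defeated\<close>.\<close>

section \<open>The well-founded model\<close>

lemma wf_model_unfold: "wf_operator P (wf_model P) = wf_model P"
  unfolding wf_model_def by (rule lfp_fixpoint[OF mono_wf_operator])

lemma wf_model_PosI:
  assumes "c \<in> P" "set (body c) \<subseteq> wf_model P"
  shows "Pos (head c) \<in> wf_model P"
  using assms by (subst wf_model_unfold[symmetric])
    (auto simp: wf_operator_def immediate_consequences_def)

lemma wf_model_NegI:
  assumes "unfounded P (wf_model P) A" "a \<in> A"
  shows "Neg a \<in> wf_model P"
  using assms by (subst wf_model_unfold[symmetric])
    (auto simp: wf_operator_def greatest_unfounded_def)

text \<open>The singleton of \<open>a\<close> serves as the unfounded set, which is enough when the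
  failure of \<open>a\<close> does not rest on a positive cycle. The mutually recursive predicates
  need \<open>wf_model_NegI\<close> with a larger set.\<close>

lemma wf_model_NegI1:
  assumes "\<And>c. c \<in> P \<Longrightarrow> head c = a \<Longrightarrow> \<exists>l\<in>set (body c). complement l \<in> wf_model P"
  shows "Neg a \<in> wf_model P"
  by (rule wf_model_NegI[of _ "{a}"]) (use assms in \<open>auto simp: unfounded_def\<close>)

text \<open>Fixpoint induction below the model: the stages \<open>J\<close> may be assumed to be contained in
  the model, and the unfounded atoms to be false in it.\<close>

lemma wf_model_induct [consumes 1, case_names Pos Neg]:
  assumes "l \<in> wf_model P"
    and Pos: "\<And>c J. c \<in> P \<Longrightarrow> J \<subseteq> wf_model P \<Longrightarrow> (\<And>l. l \<in> J \<Longrightarrow> Q l) \<Longrightarrow>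
      set (body c) \<subseteq> J \<Longrightarrow> Q (Pos (head c))"
    and Neg: "\<And>a A J. unfounded P J A \<Longrightarrow> J \<subseteq> wf_model P \<Longrightarrow> (\<And>l. l \<in> J \<Longrightarrow> Q l) \<Longrightarrow>
      (\<And>b. b \<in> A \<Longrightarrow> Neg b \<in> wf_model P) \<Longrightarrow> a \<in> A \<Longrightarrow> Q (Neg a)"
  shows "Q l"
proof -
  \<comment> \<open>The part of the model on which \<open>Q\<close> holds turns out to be closed
    under the operator, so by leastness it is the whole model.\<close>
  define J where "J = {l \<in> wf_model P. Q l}"
  have J: "J \<subseteq> wf_model P" "\<And>l. l \<in> J \<Longrightarrow> Q l"
    by (auto simp: J_def)
  have sub: "wf_operator P J \<subseteq> wf_model P"
    using monoD[OF mono_wf_operator J(1)] wf_model_unfold by blast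
  have "Q k" if "k \<in> wf_operator P J" for k
  proof -
    from that consider
        c where "k = Pos (head c)" "c \<in> P" "set (body c) \<subseteq> J"
      | a A where "k = Neg a" "unfounded P J A" "a \<in> A"
      unfolding wf_operator_def immediate_consequences_def greatest_unfounded_def by blast
    then show ?thesis
    proof cases
      case 1
      then show ?thesis using Pos J by blast
    next
      case 2
      \<comment> \<open>All of \<open>A\<close> is unfounded at stage \<open>J\<close>, so
        monotonicity puts every \<open>Neg b\<close> with \<open>b\<close> in \<open>A\<close> into
        the model, not only \<open>Neg a\<close>.\<close>
      moreover have "Neg b \<in> wf_model P" if "b \<in> A" for b
        using sub 2(2) that unfolding wf_operator_def greatest_unfounded_def by blast
      ultimately show ?thesis using Neg J by blast
    qed
  qed
  with sub have "wf_operator P J \<subseteq> J"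
    by (auto simp: J_def)
  then have "wf_model P \<subseteq> J"
    unfolding wf_model_def by (rule lfp_lowerbound)
  with assms(1) show ?thesis
    by (auto simp: J_def)
qed

lemma complement_complement [simp]: "complement (complement l) = l"
  by (cases l) auto

text \<open>If a derived atom were also false, it would lie in a set unfounded with respect to the
  model. The deriving clause would then have a body literal that is false, either directly or as a
  member of that set, against the induction hypothesis for the body.\<close>

lemma wf_model_consistent:
  assumes "l \<in> wf_model P"
  shows "complement l \<notin> wf_model P"
  using assms
proof (induction rule: wf_model_induct)
  case (Pos c J)
  show ?case
  proof
    assume "complement (Pos (head c)) \<in> wf_model P"
    then have "Neg (head c) \<in> wf_operator P (wf_model P)"
      by (simp add: wf_model_unfold)
    then obtain A where A: "unfounded P (wf_model P) A" "head c \<in> A"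
      by (auto simp: wf_operator_def greatest_unfounded_def)
    with \<open>c \<in> P\<close> consider
        k where "k \<in> set (body c)" "complement k \<in> wf_model P"
      | b where "b \<in> A" "Pos b \<in> set (body c)"
      unfolding unfounded_def by blast
    then show False
    proof cases
      case 1
      then show ?thesis using Pos by blast
    next
      case 2
      then show ?thesis
        using Pos.IH[of "Pos b"] Pos.hyps wf_model_NegI[OF A(1)] by auto
    qed
  qed
next
  case (Neg a A J)
  \<comment> \<open>The inner induction covers all of \<open>A\<close> at once: the witness of
    unfoundedness may be another atom of \<open>A\<close>, which then occurs positively in the body
    of the deriving clause.\<close>
  have "k \<in> wf_model P \<Longrightarrow> \<forall>b\<in>A. k \<noteq> Pos b" for k
  proof (induction rule: wf_model_induct)
    case (Pos c K)
    show ?case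
    proof (intro ballI notI)
      fix b
      assume "b \<in> A" "Pos (head c) = Pos b"
      with \<open>c \<in> P\<close> Neg.hyps(1) consider
          k where "k \<in> set (body c)" "complement k \<in> J"
        | d where "d \<in> A" "Pos d \<in> set (body c)"
        unfolding unfounded_def by blast
      then show False
      proof cases
        case 1
        then show ?thesis using Neg.IH[of "complement k"] Pos by auto
      next
        case 2
        then show ?thesis using Pos by blast
      qed
    qed
  qed auto
  with \<open>a \<in> A\<close> show ?case by auto
qed

lemma wf_model_not_both: "Pos a \<in> wf_model P \<Longrightarrow> Neg a \<in> wf_model P \<Longrightarrow> False"
  using wf_model_consistent[of "Pos a"] by auto

text \<open>Consistency turns two sufficient conditions into equivalences; this is how atoms decided
  by the model are recorded.\<close>

lemma wf_model_total:
  assumes "Q \<Longrightarrow> Pos a \<in> wf_model P" "\<not> Q \<Longrightarrow> Neg a \<in> wf_model P"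
  shows "Pos a \<in> wf_model P \<longleftrightarrow> Q" "Neg a \<in> wf_model P \<longleftrightarrow> \<not> Q"
  using assms wf_model_not_both[of a P] by auto

lemma ground_clausesI:
  assumes "c \<in> P" "\<And>x. x \<in> vars_clause c \<Longrightarrow> \<sigma> x \<in> U x"
  shows "map_clause (subst_atom \<sigma>) c \<in> ground_clauses U P"
  using assms by (auto simp: ground_clauses_def)

lemma wf_model_instanceI:
  assumes "c \<in> P" "\<And>x. x \<in> vars_clause c \<Longrightarrow> \<sigma> x \<in> U x"
    and "set (body (map_clause (subst_atom \<sigma>) c)) \<subseteq> wf_model (ground_clauses U P)"
  shows "Pos (head (map_clause (subst_atom \<sigma>) c)) \<in> wf_model (ground_clauses U P)"
  using wf_model_PosI[OF ground_clausesI[OF assms(1,2)] assms(3)] by simp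

section \<open>The encoding of literals and rules\<close>

lemma inj_rep_trm: "inj rep_trm"
  unfolding rep_trm_def by (rule trm.inj_map) (auto intro: injI)

lemma rep_trm_eq_iff [simp]: "rep_trm t = rep_trm u \<longleftrightarrow> t = u"
  using inj_rep_trm by (auto dest: injD)

lemma rep_lit_eq_iff [simp]: "rep_lit k = rep_lit l \<longleftrightarrow> k = l"
proof -
  have "map rep_trm ts = map rep_trm us \<longleftrightarrow> ts = us" for ts us :: "('f, 'v) trm list"
    by (rule inj_map_eq_map[OF inj_rep_trm])
  then show ?thesis
    by (cases k rule: rep_lit.cases; cases l rule: rep_lit.cases) auto
qed

lemma rep_label_eq_iff [simp]: "rep_label r = rep_label s \<longleftrightarrow> r = s"
  by (simp add: rep_label_def)

lemma mlist_simps [simp]: "mlist [] = mnil" "mlist (t # ts) = mcons t (mlist ts)"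
  by (simp_all add: mlist_def)

lemma mcons_mnil_simps [simp]:
  "mcons t u \<noteq> mnil" "mnil \<noteq> mcons t u" "mcons t u = mcons t' u' \<longleftrightarrow> t = t' \<and> u = u'"
  by (auto simp: mcons_def mnil_def)

text \<open>Allows the antecedent of a rule to be recovered from the third argument of its
  atom.\<close>

lemma mlist_rep_lit_eq_iff [simp]:
  "mlist (map rep_lit ks) = mlist (map rep_lit ls) \<longleftrightarrow> ks = ls"
proof (induction ks arbitrary: ls)
  case Nil
  then show ?case by (cases ls) auto
next
  case (Cons k ks)
  then show ?case by (cases ls) auto
qed

lemma subst_meta_simps [simp]:
  "subst_trm \<sigma> mnil = mnil"
  "subst_trm \<sigma> (mcons t u) = mcons (subst_trm \<sigma> t) (subst_trm \<sigma> u)"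
  "subst_trm \<sigma> (rep_label r) = rep_label r"
  "vars_trm mnil = {}" "vars_trm (mcons t u) = vars_trm t \<union> vars_trm u"
  "vars_trm (rep_label r) = {}"
  by (auto simp: mnil_def mcons_def rep_label_def)

lemma subst_mlist [simp]: "subst_trm \<sigma> (mlist ts) = mlist (map (subst_trm \<sigma>) ts)"
  by (induction ts) auto

lemma vars_mlist [simp]: "vars_trm (mlist ts) = \<Union> (vars_trm ` set ts)"
  by (induction ts) auto

lemma vars_rep_trm [simp]: "vars_trm (rep_trm t) = ObjVar ` vars_trm t"
  by (simp add: rep_trm_def trm.set_map)

lemma vars_rep_lit [simp]: "vars_trm (rep_lit l) = ObjVar ` vars_atom (atom_of l)"
  by (cases l rule: rep_lit.cases) auto

text \<open>The hypothesis reflects the sort of \<open>ObjVar\<close> in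
  \<open>meta_universe\<close>: object variables receive encoded ground terms only. Hence instances
  of an encoded rule are exactly encodings of instances of the rule.\<close>

lemma subst_rep_trm:
  assumes "\<And>y. y \<in> vars_trm t \<Longrightarrow> \<sigma> (ObjVar y) = rep_trm (\<tau> y)"
  shows "subst_trm \<sigma> (rep_trm t) = rep_trm (subst_trm \<tau> t)"
  using assms by (induction t) (auto simp: rep_trm_def)

lemma subst_rep_lit:
  assumes "\<And>y. y \<in> vars_atom (atom_of l) \<Longrightarrow> \<sigma> (ObjVar y) = rep_trm (\<tau> y)"
  shows "subst_trm \<sigma> (rep_lit l) = rep_lit (map_literal (subst_atom \<tau>) l)"
  using assms by (cases l rule: rep_lit.cases) (auto intro!: subst_rep_trm)

lemma subst_rep_rule:
  assumes "\<And>y. y \<in> vars_rule r \<Longrightarrow> \<sigma> (ObjVar y) = rep_trm (\<tau> y)"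
  shows "subst_atom \<sigma> (rep_rule r) = rep_rule (subst_rule \<tau> r)"
  using assms
  by (auto simp: rep_rule_def subst_rule_def vars_rule_def literals_of_rule_def antecedent_def
      intro!: subst_rep_lit arg_cong[of _ _ mlist]) blast

lemma vars_rep_rule [simp]: "vars_atom (rep_rule r) = ObjVar ` vars_rule r"
  by (auto simp: rep_rule_def vars_rule_def literals_of_rule_def antecedent_def)

lemma subst_trm_ground:
  assumes "vars_trm t = {}"
  shows "subst_trm \<sigma> t = t"
  using assms by (induction t) (auto intro: map_idI)

lemma kind_pred_simps [simp]:
  "kind_pred k = m_strict \<longleftrightarrow> k = Strict"
  "kind_pred k = m_defeasible \<longleftrightarrow> k = Defeasible"
  "kind_pred k = m_defeater \<longleftrightarrow> k = Defeater"
  "m_strict = kind_pred k \<longleftrightarrow> k = Strict"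
  "m_defeasible = kind_pred k \<longleftrightarrow> k = Defeasible"
  "m_defeater = kind_pred k \<longleftrightarrow> k = Defeater"
  by (cases k; simp)+

lemma kind_pred_other [simp]:
  assumes "p \<notin> {m_strict, m_defeasible, m_defeater}"
  shows "kind_pred k \<noteq> p" "p \<noteq> kind_pred k"
  using assms by (cases k; auto)+

section \<open>Encodings and instances inside the Herbrand universe\<close>

lemma rep_trm_meta:
  assumes "t \<in> ground_terms \<Sigma>"
  shows "rep_trm t \<in> ground_terms (meta_signature \<Sigma> D)"
  using assms by (induction t) (auto simp: ground_terms_def rep_trm_def meta_signature_def)

lemma rep_lit_meta:
  assumes "q \<in> ground_literals \<Sigma> D"
  shows "rep_lit q \<in> ground_terms (meta_signature \<Sigma> D)"
proof -
  have "wf_trm (meta_signature \<Sigma> D) (rep_trm t) \<and> vars_trm t = {}"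
    if "t \<in> set (args (atom_of q))" for t
    using that assms rep_trm_meta[of t \<Sigma> D]
    by (auto simp: ground_literals_def ground_terms_def)
  then show ?thesis
    using assms
    by (cases q rule: rep_lit.cases)
      (auto simp: ground_literals_def ground_terms_def meta_signature_def)
qed

lemma rep_label_meta: "r \<in> rules D \<Longrightarrow> rep_label (label r) \<in> ground_terms (meta_signature \<Sigma> D)"
  by (auto simp: rep_label_def ground_terms_def meta_signature_def)

lemma mnil_meta: "mnil \<in> ground_terms (meta_signature \<Sigma> D)"
  by (auto simp: mnil_def ground_terms_def meta_signature_def)

lemma mcons_meta:
  "mcons t u \<in> ground_terms (meta_signature \<Sigma> D) \<longleftrightarrow>
     t \<in> ground_terms (meta_signature \<Sigma> D) \<and> u \<in> ground_terms (meta_signature \<Sigma> D)"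
  by (auto simp: mcons_def ground_terms_def meta_signature_def)

lemma mlist_meta:
  "set qs \<subseteq> ground_literals \<Sigma> D \<Longrightarrow>
     mlist (map rep_lit qs) \<in> ground_terms (meta_signature \<Sigma> D)"
  by (induction qs) (auto simp: mnil_meta mcons_meta rep_lit_meta)

lemma atom_of_complement [simp]: "atom_of (complement l) = atom_of l"
  by (cases l) auto

lemma complement_ground [simp]:
  "complement q \<in> ground_literals \<Sigma> D \<longleftrightarrow> q \<in> ground_literals \<Sigma> D"
  by (simp add: ground_literals_def)

lemma meta_universe_simps [simp]:
  "meta_universe \<Sigma> D (ObjVar y) = rep_trm ` ground_terms \<Sigma>"
  "meta_universe \<Sigma> D (ArgVar i) = ground_terms (meta_signature \<Sigma> D)"
  "v \<in> {VR, VH, VB, VT, VX, VX', VY, VS, VU, VV} \<Longrightarrow>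
     meta_universe \<Sigma> D v = ground_terms (meta_signature \<Sigma> D)"
  by (auto simp: meta_universe_def)

lemma subst_trm_ground_terms:
  assumes "wf_trm \<Sigma> t" "\<And>x. x \<in> vars_trm t \<Longrightarrow> \<sigma> x \<in> ground_terms \<Sigma>"
  shows "subst_trm \<sigma> t \<in> ground_terms \<Sigma>"
  using assms by (induction t) (auto simp: ground_terms_def)

lemma subst_lit_ground:
  assumes "l \<in> literals_of_theory D" "\<forall>t\<in>set (args (atom_of l)). wf_trm \<Sigma> t"
    and "\<And>x. x \<in> vars_atom (atom_of l) \<Longrightarrow> \<sigma> x \<in> ground_terms \<Sigma>"
  shows "map_literal (subst_atom \<sigma>) l \<in> ground_literals \<Sigma> D"
proof -
  have "pred_of (atom_of (map_literal (subst_atom \<sigma>) l)) = pred_of (atom_of l)"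
    by (cases l rule: rep_lit.cases) auto
  then have "pred_of (atom_of (map_literal (subst_atom \<sigma>) l)) \<in> predicates_of D"
    using assms(1) by (auto simp: predicates_of_def)
  moreover have "set (args (atom_of (map_literal (subst_atom \<sigma>) l))) \<subseteq> ground_terms \<Sigma>"
    using assms(2,3) by (cases l rule: rep_lit.cases) (auto intro!: subst_trm_ground_terms)
  ultimately show ?thesis
    by (simp add: ground_literals_def)
qed

text \<open>Substitution keeps predicates and inserts only ground terms over
  \<open>\<Sigma>\<close>, so no instance leaves the language of \<open>D\<close>. This supplies the
  sort conditions of clause instances and the \<open>m_neg\<close> facts for conclusions.\<close>

lemma ground_rule_literals:
  assumes D: "defeasible_theory \<Sigma> D" and r: "r \<in> ground_rules \<Sigma> D"
  shows "concl r \<in> ground_literals \<Sigma> D" "antecedent r \<subseteq> ground_literals \<Sigma> D"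
proof -
  obtain \<sigma> r' where r': "r = subst_rule \<sigma> r'" "r' \<in> rules D"
    and \<sigma>: "\<forall>x\<in>vars_rule r'. \<sigma> x \<in> ground_terms \<Sigma>"
    using r by (auto simp: ground_rules_def)
  have "map_literal (subst_atom \<sigma>) l \<in> ground_literals \<Sigma> D" if "l \<in> literals_of_rule r'" for l
  proof (rule subst_lit_ground)
    show "l \<in> literals_of_theory D"
      using that r' by (auto simp: literals_of_theory_def)
    then show "\<forall>t\<in>set (args (atom_of l)). wf_trm \<Sigma> t"
      using D by (auto simp: defeasible_theory_def)
    show "\<sigma> x \<in> ground_terms \<Sigma>" if "x \<in> vars_atom (atom_of l)" for x
      using that \<sigma> \<open>l \<in> literals_of_rule r'\<close> by (auto simp: vars_rule_def)
  qed
  then show "concl r \<in> ground_literals \<Sigma> D" "antecedent r \<subseteq> ground_literals \<Sigma> D"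
    by (auto simp: r' subst_rule_def literals_of_rule_def antecedent_def)
qed

lemma ground_rule_label:
  "r \<in> ground_rules \<Sigma> D \<Longrightarrow> rep_label (label r) \<in> ground_terms (meta_signature \<Sigma> D)"
  by (auto simp: ground_rules_def subst_rule_def rep_label_meta)

lemma facts_ground:
  assumes "defeasible_theory \<Sigma> D"
  shows "facts D \<subseteq> ground_literals \<Sigma> D"
proof
  fix q
  assume q: "q \<in> facts D"
  then have lit: "q \<in> literals_of_theory D"
    by (simp add: literals_of_theory_def)
  then have "\<forall>t\<in>set (args (atom_of q)). wf_trm \<Sigma> t" "vars_atom (atom_of q) = {}"
    using assms q by (auto simp: defeasible_theory_def)
  then have "set (args (atom_of q)) \<subseteq> ground_terms \<Sigma>"
    by (cases q rule: rep_lit.cases) (auto simp: ground_terms_def)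
  with lit show "q \<in> ground_literals \<Sigma> D"
    by (auto simp: ground_literals_def predicates_of_def)
qed

lemma P_Delta_ground:
  assumes "defeasible_theory \<Sigma> D"
  shows "P_Delta \<Sigma> D \<subseteq> ground_literals \<Sigma> D"
proof
  fix q
  assume "q \<in> P_Delta \<Sigma> D"
  then show "q \<in> ground_literals \<Sigma> D"
  proof induction
    case (1 q)
    then show ?case using facts_ground[OF assms] by blast
  next
    case (2 r q)
    then show ?case
      using ground_rule_literals(1)[OF assms, of r] by (auto simp: Rs_for_def R_for_def)
  qed
qed

section \<open>The part of the metaprograms below defeasible conclusions\<close>

text \<open>Covers both metaprograms, so that their common strata are treated once. The condition
  \<open>heads\<close> confines the additional clauses to four predicates; it ignores arities
  because \<open>m_overruled\<close> has one argument in one program and two in the other.\<close>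

locale metaprogram =
  fixes \<Sigma> :: "('f \<times> nat) set"
    and D :: "('p, 'f, 'v, 'l) dtheory"
    and P :: "('p, 'f, 'v, 'l) matom clause set"
  assumes dtheory: "defeasible_theory \<Sigma> D"
    and base: "representation D \<union> common_clauses \<subseteq> P"
    and heads: "c \<in> P - (representation D \<union> common_clauses) \<Longrightarrow>
      fst (pred_of (head c)) \<in> {m_defeasibly, m_overruled, m_defeated, m_defeats}"
begin

abbreviation "ground_program \<equiv> ground_clauses (meta_universe \<Sigma> D) P"

abbreviation "W \<equiv> wf_model ground_program"

abbreviation "HU \<equiv> ground_terms (meta_signature \<Sigma> D)"

lemmas program_defs = representation_def common_clauses_def loop_clauses_def neg_clauses_def
  Let_def

lemma instanceI:
  assumes "c \<in> P" "\<forall>x\<in>vars_clause c. \<sigma> x \<in> meta_universe \<Sigma> D x"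
    and "set (body (map_clause (subst_atom \<sigma>) c)) \<subseteq> W"
  shows "Pos (head (map_clause (subst_atom \<sigma>) c)) \<in> W"
  using wf_model_instanceI[OF assms(1) _ assms(3)] assms(2) by simp

lemma pred_map_clause:
  "fst (pred_of (head (map_clause (subst_atom \<sigma>) c))) = fst (pred_of (head c))"
  by (cases c; cases "head c") auto

lemma program_clauseE:
  assumes "c \<in> ground_program" "head c = Atom pr ts"
    and "pr \<notin> {m_defeasibly, m_overruled, m_defeated, m_defeats}"
  obtains c' \<sigma> where "c' \<in> representation D \<union> common_clauses"
    "c = map_clause (subst_atom \<sigma>) c'"
    "\<And>x. x \<in> vars_clause c' \<Longrightarrow> \<sigma> x \<in> meta_universe \<Sigma> D x"
proof -
  obtain c' \<sigma> where c': "c' \<in> P" "c = map_clause (subst_atom \<sigma>) c'"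
    "\<And>x. x \<in> vars_clause c' \<Longrightarrow> \<sigma> x \<in> meta_universe \<Sigma> D x"
    using assms(1) by (auto simp: ground_clauses_def)
  with assms(2,3) heads[of c'] have "c' \<in> representation D \<union> common_clauses"
    by (auto simp: pred_map_clause[of \<sigma> c', symmetric])
  with c' that show ?thesis
    by blast
qed

section \<open>Ground clauses classified by head predicate\<close>

lemma definitely_clause:
  assumes "c \<in> ground_program" "head c = Atom m_definitely ts"
  shows "\<exists>x r y. ts = [x] \<and> (body c = [Pos (Atom m_fact [x])] \<or>
    body c = [Pos (Atom m_strict [r, x, y]), Pos (Atom m_loop_definitely [y])])"
  using assms
  by (elim program_clauseE) (auto simp: program_defs rep_rule_def)

text \<open>\<open>m_loop_defeasibly\<close> is included although it depends on
  \<open>m_defeasibly\<close>: only the shape of its clauses is at issue, and these all come from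
  \<open>common_clauses\<close>.\<close>

lemma loop_clause:
  assumes "c \<in> ground_program" "head c = Atom lp ts"
    and "(lp, tau) \<in> {(m_loop_definitely, m_definitely), (m_loop_lambda, m_lambda),
      (m_loop_defeasibly, m_defeasibly)}"
  shows "\<exists>h t. ts = [mnil] \<and> body c = [] \<or>
    ts = [mcons h t] \<and> body c = [Pos (Atom tau [h]), Pos (Atom lp [t])]"
  using assms
  by (elim program_clauseE) (auto simp: program_defs rep_rule_def)

lemma lambda_clause:
  assumes "c \<in> ground_program" "head c = Atom m_lambda ts"
  shows "\<exists>x x' r y. ts = [x] \<and> (body c = [Pos (Atom m_definitely [x])] \<or>
    body c = [Pos (Atom m_neg [x, x']), Neg (Atom m_definitely [x']),
      Pos (Atom m_strict_or_defeasible [r, x, y]), Pos (Atom m_loop_lambda [y])])"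
  using assms
  by (elim program_clauseE) (auto simp: program_defs rep_rule_def)

lemma fact_clause:
  assumes "c \<in> ground_program" "head c = Atom m_fact ts"
  shows "\<exists>q\<in>facts D. ts = [rep_lit q]"
proof -
  have "subst_trm \<sigma> (rep_lit q) = rep_lit q" if "q \<in> facts D"
    for \<sigma> :: "'v mvar \<Rightarrow> ('p, 'f, 'v, 'l) mtrm" and q
    using that dtheory by (intro subst_trm_ground) (auto simp: defeasible_theory_def)
  with assms show ?thesis
    by (elim program_clauseE) (auto simp: program_defs rep_rule_def)
qed

lemma rule_fact_clause:
  assumes "c \<in> ground_program" "head c = Atom (kind_pred k) ts"
  shows "\<exists>r\<in>ground_rules \<Sigma> D. kind r = k \<and>
    ts = [rep_label (label r), rep_lit (concl r), mlist (map rep_lit (ante r))]"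
proof -
  have k: "kind_pred k \<notin> {m_defeasibly, m_overruled, m_defeated, m_defeats}"
    by auto
  obtain c' \<sigma> where c': "c' \<in> representation D \<union> common_clauses"
    "c = map_clause (subst_atom \<sigma>) c'"
    and \<sigma>: "\<And>x. x \<in> vars_clause c' \<Longrightarrow> \<sigma> x \<in> meta_universe \<Sigma> D x"
    by (rule program_clauseE[OF assms k]) (rule that)
  then obtain r where r: "r \<in> rules D" "c' = (rep_rule r :- [])" "kind_pred (kind r) = kind_pred k"
    using assms(2) by (auto simp: program_defs rep_rule_def)
  \<comment> \<open>By its sort, each object variable has an encoded ground term as its value.
    Decoding these values yields the substitution \<open>\<tau>\<close> on the side of
    \<open>D\<close>.\<close>
  then have "\<sigma> (ObjVar y) \<in> rep_trm ` ground_terms \<Sigma>" if "y \<in> vars_rule r" for y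
    using \<sigma>[of "ObjVar y"] that by (simp add: vars_clause_def)
  then have "\<forall>y\<in>vars_rule r. \<exists>t\<in>ground_terms \<Sigma>. \<sigma> (ObjVar y) = rep_trm t"
    by blast
  then obtain \<tau> where \<tau>: "\<And>y. y \<in> vars_rule r \<Longrightarrow>
      \<tau> y \<in> ground_terms \<Sigma> \<and> \<sigma> (ObjVar y) = rep_trm (\<tau> y)"
    by metis
  have "head c = rep_rule (subst_rule \<tau> r)"
    using c' r subst_rep_rule[of r \<sigma> \<tau>] \<tau> by simp
  moreover have "subst_rule \<tau> r \<in> ground_rules \<Sigma> D"
    using r(1) \<tau> by (auto simp: ground_rules_def)
  moreover have "kind r = k"
    using r(3) by (cases k) auto
  ultimately show ?thesis
    using assms(2) by (intro bexI[of _ "subst_rule \<tau> r"]) (auto simp: rep_rule_def subst_rule_def)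
qed

lemma sup_clause:
  assumes "c \<in> ground_program" "head c = Atom m_sup ts"
  shows "\<exists>r s. (r, s) \<in> superior D \<and> ts = [rep_label r, rep_label s]"
  using assms
  by (elim program_clauseE) (auto simp: program_defs rep_rule_def)

text \<open>The variables \<open>ArgVar\<close> range over the whole Herbrand universe, so
  \<open>us\<close> may contain labels or lists and need not encode arguments of a literal. The
  shape alone still forces one side once the other is known to be an encoded literal.\<close>

lemma neg_clause:
  assumes "c \<in> ground_program" "head c = Atom m_neg ts"
  shows "\<exists>p us. ts = [Fun (PredSym p) us, Fun (NotPredSym p) us] \<or>
    ts = [Fun (NotPredSym p) us, Fun (PredSym p) us]"
  using assms
  by (elim program_clauseE) (auto simp: program_defs rep_rule_def)

lemma strict_or_defeasible_clause:
  assumes "c \<in> ground_program" "head c = Atom m_strict_or_defeasible ts"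
  shows "\<exists>k\<in>{Strict, Defeasible}. body c = [Pos (Atom (kind_pred k) ts)]"
  using assms
  by (elim program_clauseE) (auto simp: program_defs rep_rule_def)

lemma rule_clause:
  assumes "c \<in> ground_program" "head c = Atom m_rule ts"
  shows "body c \<in> {[Pos (Atom m_strict_or_defeasible ts)], [Pos (Atom m_defeater ts)]}"
  using assms
  by (elim program_clauseE) (auto simp: program_defs rep_rule_def)

section \<open>Atoms that are false in the well-founded model\<close>

lemma fact_fails:
  assumes "x \<notin> rep_lit ` facts D"
  shows "Neg (Atom m_fact [x]) \<in> W"
  by (rule wf_model_NegI1) (use assms in \<open>auto dest: fact_clause\<close>)

lemma rule_fact_fails:
  assumes "\<And>r. r \<in> ground_rules \<Sigma> D \<Longrightarrow> kind r = k \<Longrightarrow>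
    ts \<noteq> [rep_label (label r), rep_lit (concl r), mlist (map rep_lit (ante r))]"
  shows "Neg (Atom (kind_pred k) ts) \<in> W"
  by (rule wf_model_NegI1) (use assms in \<open>blast dest: rule_fact_clause\<close>)

lemma strict_or_defeasible_fails:
  assumes "\<And>r. r \<in> ground_rules \<Sigma> D \<Longrightarrow> kind r \<noteq> Defeater \<Longrightarrow>
    ts \<noteq> [rep_label (label r), rep_lit (concl r), mlist (map rep_lit (ante r))]"
  shows "Neg (Atom m_strict_or_defeasible ts) \<in> W"
proof (rule wf_model_NegI1)
  fix c
  assume "c \<in> ground_program" "head c = Atom m_strict_or_defeasible ts"
  from strict_or_defeasible_clause[OF this] obtain k where
    "k \<noteq> Defeater" "body c = [Pos (Atom (kind_pred k) ts)]"
    by auto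
  moreover have "Neg (Atom (kind_pred k) ts) \<in> W"
    by (rule rule_fact_fails) (use assms \<open>k \<noteq> Defeater\<close> in auto)
  ultimately show "\<exists>l\<in>set (body c). complement l \<in> W"
    by simp
qed

lemma rule_fails:
  assumes "\<And>r. r \<in> ground_rules \<Sigma> D \<Longrightarrow>
    ts \<noteq> [rep_label (label r), rep_lit (concl r), mlist (map rep_lit (ante r))]"
  shows "Neg (Atom m_rule ts) \<in> W"
proof (rule wf_model_NegI1)
  fix c
  assume "c \<in> ground_program" "head c = Atom m_rule ts"
  from rule_clause[OF this] show "\<exists>l\<in>set (body c). complement l \<in> W"
    using strict_or_defeasible_fails[of ts] rule_fact_fails[of Defeater ts] assms by auto
qed

lemma sup_fails:
  assumes "\<And>r s. (r, s) \<in> superior D \<Longrightarrow> ts \<noteq> [rep_label r, rep_label s]"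
  shows "Neg (Atom m_sup ts) \<in> W"
  by (rule wf_model_NegI1) (use assms in \<open>blast dest: sup_clause\<close>)

lemma neg_rep_litD:
  assumes "c \<in> ground_program" "head c = Atom m_neg [x, y]"
  shows "x = rep_lit q \<Longrightarrow> y = rep_lit (complement q)"
    "y = rep_lit q \<Longrightarrow> x = rep_lit (complement q)"
  using neg_clause[OF assms] by (cases q rule: rep_lit.cases; auto)+

lemma neg_fails:
  assumes "x = rep_lit q \<and> y \<noteq> rep_lit (complement q) \<or>
    y = rep_lit q \<and> x \<noteq> rep_lit (complement q)"
  shows "Neg (Atom m_neg [x, y]) \<in> W"
  by (rule wf_model_NegI1) (use assms in \<open>blast dest: neg_rep_litD\<close>)

text \<open>Underivable literals may support each other in a cycle, so they have to fail together,
  along with the lists that contain them. A strict rule for an underivable literal has an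
  underivable antecedent, which puts its list atom into \<open>A\<close>; for such a list the head
  or the tail is again in \<open>A\<close>.\<close>

lemma definitely_unfounded:
  defines "A \<equiv> {Atom m_definitely [rep_lit q] | q. q \<notin> P_Delta \<Sigma> D} \<union>
    {Atom m_loop_definitely [mlist (map rep_lit qs)] | qs. \<not> set qs \<subseteq> P_Delta \<Sigma> D}"
  shows "unfounded ground_program W A"
  unfolding unfounded_def
proof (intro ballI impI)
  fix c
  assume c: "c \<in> ground_program" "head c \<in> A"
  then consider
      q where "head c = Atom m_definitely [rep_lit q]" "q \<notin> P_Delta \<Sigma> D"
    | qs where "head c = Atom m_loop_definitely [mlist (map rep_lit qs)]"
        "\<not> set qs \<subseteq> P_Delta \<Sigma> D"
    by (auto simp: A_def)
  then show "(\<exists>l\<in>set (body c). complement l \<in> W) \<or> (\<exists>a\<in>A. Pos a \<in> set (body c))"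
  proof cases
    case 1
    from definitely_clause[OF c(1) 1(1)] obtain r y where
      "body c = [Pos (Atom m_fact [rep_lit q])] \<or>
       body c = [Pos (Atom m_strict [r, rep_lit q, y]), Pos (Atom m_loop_definitely [y])]"
      by auto
    then show ?thesis
    proof
      assume "body c = [Pos (Atom m_fact [rep_lit q])]"
      moreover have "Neg (Atom m_fact [rep_lit q]) \<in> W"
        by (rule fact_fails) (use 1(2) in \<open>auto intro: P_Delta.intros\<close>)
      ultimately show ?thesis
        by simp
    next
      assume b: "body c = [Pos (Atom m_strict [r, rep_lit q, y]), Pos (Atom m_loop_definitely [y])]"
      show ?thesis
      proof (cases "\<exists>s\<in>ground_rules \<Sigma> D. kind s = Strict \<and> [r, rep_lit q, y] =
          [rep_label (label s), rep_lit (concl s), mlist (map rep_lit (ante s))]")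
        case True
        then obtain s where s: "s \<in> ground_rules \<Sigma> D" "kind s = Strict" "q = concl s"
          "y = mlist (map rep_lit (ante s))"
          by auto
        then have "\<not> set (ante s) \<subseteq> P_Delta \<Sigma> D"
          using 1(2) P_Delta.intros(2)[of s \<Sigma> D q]
          by (auto simp: Rs_for_def R_for_def antecedent_def)
        then have "Atom m_loop_definitely [y] \<in> A"
          using s(4) by (auto simp: A_def)
        then show ?thesis
          using b by auto
      next
        case False
        then show ?thesis
          using rule_fact_fails[of Strict "[r, rep_lit q, y]"] b by auto
      qed
    qed
  next
    case 2
    obtain q qs' where qs: "qs = q # qs'"
      using 2(2) by (cases qs) auto
    with loop_clause[OF c(1) 2(1), of m_definitely]
    have "body c = [Pos (Atom m_definitely [rep_lit q]),
        Pos (Atom m_loop_definitely [mlist (map rep_lit qs')])]"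
      by auto
    moreover have "Atom m_definitely [rep_lit q] \<in> A \<or>
        Atom m_loop_definitely [mlist (map rep_lit qs')] \<in> A"
      using 2(2) qs by (auto simp: A_def)
    ultimately show ?thesis
      by auto
  qed
qed

lemma definitely_fails: "q \<notin> P_Delta \<Sigma> D \<Longrightarrow> Neg (Atom m_definitely [rep_lit q]) \<in> W"
  by (rule wf_model_NegI[OF definitely_unfounded]) auto

section \<open>Atoms that are true in the well-founded model\<close>

lemma subst_Var: "subst_trm Var t = t"
  by (induction t) (auto intro: map_idI)

lemma fact_holds:
  assumes "q \<in> facts D"
  shows "Pos (Atom m_fact [rep_lit q]) \<in> W"
proof -
  have "vars_trm (rep_lit q :: ('p, 'f, 'v, 'l) mtrm) = {}"
    using assms dtheory by (auto simp: defeasible_theory_def)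
  moreover have "(Atom m_fact [rep_lit q] :- []) \<in> P"
    using assms by (intro subsetD[OF base]) (auto simp: representation_def)
  \<comment> \<open>The clause has no variables, so the substitution \<open>Var\<close> meets the
    sort conditions vacuously and leaves the clause as it is.\<close>
  ultimately show ?thesis
    using instanceI[of "Atom m_fact [rep_lit q] :- []" Var]
    by (simp add: vars_clause_def subst_Var)
qed

lemma rule_fact_holds:
  assumes "r \<in> ground_rules \<Sigma> D"
  shows "Pos (rep_rule r) \<in> W"
proof -
  obtain \<tau> r' where r: "r = subst_rule \<tau> r'" "r' \<in> rules D"
    and \<tau>: "\<forall>y\<in>vars_rule r'. \<tau> y \<in> ground_terms \<Sigma>"
    using assms by (auto simp: ground_rules_def)
  \<comment> \<open>The encoding of \<open>\<tau>\<close>; the value \<open>mnil\<close> is only a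
    filler, since an encoded rule has no variables other than \<open>ObjVar\<close>.\<close>
  define \<sigma> :: "'v mvar \<Rightarrow> ('p, 'f, 'v, 'l) mtrm"
    where "\<sigma> x = (case x of ObjVar y \<Rightarrow> rep_trm (\<tau> y) | _ \<Rightarrow> mnil)" for x
  have "subst_atom \<sigma> (rep_rule r') = rep_rule r"
    unfolding r by (rule subst_rep_rule) (simp add: \<sigma>_def)
  moreover have "(rep_rule r' :- []) \<in> P"
    using r by (intro subsetD[OF base]) (auto simp: representation_def)
  ultimately show ?thesis
    using instanceI[of "rep_rule r' :- []" \<sigma>] \<tau> by (auto simp: vars_clause_def \<sigma>_def)
qed

lemma sup_holds:
  assumes "(r, s) \<in> superior D"
  shows "Pos (Atom m_sup [rep_label r, rep_label s]) \<in> W"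
proof -
  have "(Atom m_sup [rep_label r, rep_label s] :- []) \<in> P"
    using assms by (intro subsetD[OF base]) (auto simp: representation_def)
  then show ?thesis
    using instanceI[of "Atom m_sup [rep_label r, rep_label s] :- []" Var]
    by (simp add: vars_clause_def)
qed

lemma neg_holds:
  assumes "q \<in> ground_literals \<Sigma> D"
  shows "Pos (Atom m_neg [rep_lit q, rep_lit (complement q)]) \<in> W"
proof -
  obtain p ts where a: "atom_of q = Atom p ts"
    by (cases "atom_of q")
  then have p: "(p, length ts) \<in> predicates_of D" "set ts \<subseteq> ground_terms \<Sigma>"
    using assms by (auto simp: ground_literals_def)
  \<comment> \<open>The argument variable with index \<open>i\<close> receives the encoded argument
    \<open>ts ! i\<close>. Which of the two orientations of the \<open>m_neg\<close> clause yields
    the claim depends on the sign of \<open>q\<close>.\<close>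
  define \<sigma> :: "'v mvar \<Rightarrow> ('p, 'f, 'v, 'l) mtrm"
    where "\<sigma> x = (case x of ArgVar i \<Rightarrow> rep_trm (ts ! i) | _ \<Rightarrow> mnil)" for x
  define xs :: "('p, 'f, 'v, 'l) mtrm list" where "xs = map (\<lambda>i. Var (ArgVar i)) [0..<length ts]"
  have xs: "map (subst_trm \<sigma>) xs = map rep_trm ts"
    by (auto simp: xs_def \<sigma>_def intro: nth_equalityI)
  have \<sigma>: "\<sigma> x \<in> meta_universe \<Sigma> D x" if "x \<in> \<Union> (vars_trm ` set xs)" for x
    using that p(2) by (auto simp: xs_def \<sigma>_def intro!: rep_trm_meta dest!: nth_mem)
  let ?pos = "Fun (PredSym p) xs" and ?neg = "Fun (NotPredSym p) xs"
  have "(Atom m_neg [?pos, ?neg] :- []) \<in> P" "(Atom m_neg [?neg, ?pos] :- []) \<in> P"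
    using p(1) by (force intro!: subsetD[OF base]
        simp: representation_def neg_clauses_def Let_def xs_def)+
  then have "Pos (Atom m_neg [subst_trm \<sigma> ?pos, subst_trm \<sigma> ?neg]) \<in> W"
    "Pos (Atom m_neg [subst_trm \<sigma> ?neg, subst_trm \<sigma> ?pos]) \<in> W"
    using instanceI[of "Atom m_neg [?pos, ?neg] :- []" \<sigma>]
      instanceI[of "Atom m_neg [?neg, ?pos] :- []" \<sigma>] \<sigma>
    by (auto simp: vars_clause_def)
  then show ?thesis
    using a xs by (cases q) auto
qed

text \<open>The common clauses other than the loops, read as closure properties of the model;
  membership in \<open>HU\<close> discharges the sort conditions. In the substitutions below, the
  constant function before the updates gives the value of the variable that is not updated.\<close>

lemma common_holds:
  "k \<in> {Strict, Defeasible} \<Longrightarrow> {r, h, b} \<subseteq> HU \<Longrightarrow> Pos (Atom (kind_pred k) [r, h, b]) \<in> W \<Longrightarrow>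
     Pos (Atom m_strict_or_defeasible [r, h, b]) \<in> W"
  "{r, h, b} \<subseteq> HU \<Longrightarrow> Pos (Atom m_strict_or_defeasible [r, h, b]) \<in> W \<Longrightarrow>
     Pos (Atom m_rule [r, h, b]) \<in> W"
  "{r, h, b} \<subseteq> HU \<Longrightarrow> Pos (Atom m_defeater [r, h, b]) \<in> W \<Longrightarrow>
     Pos (Atom m_rule [r, h, b]) \<in> W"
  "x \<in> HU \<Longrightarrow> Pos (Atom m_fact [x]) \<in> W \<Longrightarrow> Pos (Atom m_definitely [x]) \<in> W"
  "{r, x, y} \<subseteq> HU \<Longrightarrow> Pos (Atom m_strict [r, x, y]) \<in> W \<Longrightarrow>
     Pos (Atom m_loop_definitely [y]) \<in> W \<Longrightarrow> Pos (Atom m_definitely [x]) \<in> W"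
  "x \<in> HU \<Longrightarrow> Pos (Atom m_definitely [x]) \<in> W \<Longrightarrow> Pos (Atom m_lambda [x]) \<in> W"
  "{r, x, x', y} \<subseteq> HU \<Longrightarrow> Pos (Atom m_neg [x, x']) \<in> W \<Longrightarrow>
     Neg (Atom m_definitely [x']) \<in> W \<Longrightarrow>
     Pos (Atom m_strict_or_defeasible [r, x, y]) \<in> W \<Longrightarrow>
     Pos (Atom m_loop_lambda [y]) \<in> W \<Longrightarrow> Pos (Atom m_lambda [x]) \<in> W"
  "x \<in> HU \<Longrightarrow> Pos (Atom m_definitely [x]) \<in> W \<Longrightarrow> Pos (Atom m_defeasibly [x]) \<in> W"
  subgoal
    using instanceI[OF subsetD[OF base], of "Atom m_strict_or_defeasible [Var VR, Var VH, Var VB] :-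
        [Pos (Atom (kind_pred k) [Var VR, Var VH, Var VB])]" "(\<lambda>_. r)(VH := h, VB := b)"]
    by (auto simp: common_clauses_def vars_clause_def)
  subgoal
    using instanceI[OF subsetD[OF base], of "Atom m_rule [Var VR, Var VH, Var VB] :-
        [Pos (Atom m_strict_or_defeasible [Var VR, Var VH, Var VB])]" "(\<lambda>_. r)(VH := h, VB := b)"]
    by (auto simp: common_clauses_def vars_clause_def)
  subgoal
    using instanceI[OF subsetD[OF base], of "Atom m_rule [Var VR, Var VH, Var VB] :-
        [Pos (Atom m_defeater [Var VR, Var VH, Var VB])]" "(\<lambda>_. r)(VH := h, VB := b)"]
    by (auto simp: common_clauses_def vars_clause_def)
  subgoal
    using instanceI[OF subsetD[OF base], of "Atom m_definitely [Var VX] :- [Pos (Atom m_fact [Var VX])]" "\<lambda>_. x"]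
    by (auto simp: common_clauses_def vars_clause_def)
  subgoal
    using instanceI[OF subsetD[OF base], of "Atom m_definitely [Var VX] :- [Pos (Atom m_strict [Var VR, Var VX, Var VY]),
        Pos (Atom m_loop_definitely [Var VY])]" "(\<lambda>_. r)(VX := x, VY := y)"]
    by (auto simp: common_clauses_def vars_clause_def)
  subgoal
    using instanceI[OF subsetD[OF base], of "Atom m_lambda [Var VX] :- [Pos (Atom m_definitely [Var VX])]" "\<lambda>_. x"]
    by (auto simp: common_clauses_def vars_clause_def)
  subgoal
    using instanceI[OF subsetD[OF base], of "Atom m_lambda [Var VX] :-
        [Pos (Atom m_neg [Var VX, Var VX']),
         Neg (Atom m_definitely [Var VX']),
         Pos (Atom m_strict_or_defeasible [Var VR, Var VX, Var VY]),
         Pos (Atom m_loop_lambda [Var VY])]" "(\<lambda>_. r)(VX := x, VX' := x', VY := y)"]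
    by (auto simp: common_clauses_def vars_clause_def)
  subgoal
    using instanceI[OF subsetD[OF base], of "Atom m_defeasibly [Var VX] :- [Pos (Atom m_definitely [Var VX])]" "\<lambda>_. x"]
    by (auto simp: common_clauses_def vars_clause_def)
  done

lemma loop_holds:
  assumes "(lp, tau) \<in> {(m_loop_definitely, m_definitely), (m_loop_lambda, m_lambda),
      (m_loop_defeasibly, m_defeasibly)}"
    and "set qs \<subseteq> ground_literals \<Sigma> D" "\<forall>q\<in>set qs. Pos (Atom tau [rep_lit q]) \<in> W"
  shows "Pos (Atom lp [mlist (map rep_lit qs)]) \<in> W"
proof -
  have "loop_clauses lp tau \<subseteq> common_clauses"
    using assms(1) by (auto simp: common_clauses_def)
  then have loop: "loop_clauses lp tau \<subseteq> P"
    using base by blast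
  show ?thesis
    using assms(2,3)
  proof (induction qs)
    case Nil
    show ?case
      using instanceI[of "Atom lp [mnil] :- []" Var] loop
      by (auto simp: loop_clauses_def vars_clause_def)
  next
    case (Cons q qs)
    then show ?case
      using instanceI[of "Atom lp [mcons (Var VH) (Var VT)] :-
          [Pos (Atom tau [Var VH]), Pos (Atom lp [Var VT])]"
          "(\<lambda>_. rep_lit q)(VT := mlist (map rep_lit qs))"] loop
      by (auto simp: loop_clauses_def vars_clause_def rep_lit_meta mlist_meta)
  qed
qed

lemma ground_rule_meta:
  assumes "r \<in> ground_rules \<Sigma> D"
  shows "{rep_label (label r), rep_lit (concl r), mlist (map rep_lit (ante r))} \<subseteq> HU"
  using ground_rule_label[OF assms] ground_rule_literals[OF dtheory assms]
  by (auto simp: antecedent_def intro!: rep_lit_meta mlist_meta)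

lemma strict_or_defeasible_holds:
  assumes "r \<in> ground_rules \<Sigma> D" "kind r \<noteq> Defeater"
  shows "Pos (Atom m_strict_or_defeasible
    [rep_label (label r), rep_lit (concl r), mlist (map rep_lit (ante r))]) \<in> W"
proof (rule common_holds(1))
  show "kind r \<in> {Strict, Defeasible}"
    using assms(2) by (cases "kind r") auto
qed (use rule_fact_holds[OF assms(1)] ground_rule_meta[OF assms(1)] in \<open>auto simp: rep_rule_def\<close>)

lemma rule_holds:
  assumes "r \<in> ground_rules \<Sigma> D"
  shows "Pos (Atom m_rule
    [rep_label (label r), rep_lit (concl r), mlist (map rep_lit (ante r))]) \<in> W"
proof (cases "kind r = Defeater")
  case True
  then show ?thesis
    using rule_fact_holds[OF assms] ground_rule_meta[OF assms]
    by (intro common_holds(3)) (auto simp: rep_rule_def)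
next
  case False
  then show ?thesis
    using strict_or_defeasible_holds[OF assms] ground_rule_meta[OF assms]
    by (intro common_holds(2)) auto
qed

lemma definitely_holds: "q \<in> P_Delta \<Sigma> D \<Longrightarrow> Pos (Atom m_definitely [rep_lit q]) \<in> W"
proof (induction rule: P_Delta.induct)
  case (1 q)
  then show ?case
    using fact_holds facts_ground[OF dtheory] by (intro common_holds(4)) (auto intro: rep_lit_meta)
next
  case (2 r q)
  then have r: "r \<in> ground_rules \<Sigma> D" "kind r = Strict" "concl r = q"
    by (auto simp: Rs_for_def R_for_def)
  have "Pos (Atom m_loop_definitely [mlist (map rep_lit (ante r))]) \<in> W"
    by (rule loop_holds[of _ m_definitely])
      (use 2 ground_rule_literals(2)[OF dtheory r(1)] in \<open>auto simp: antecedent_def\<close>)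
  then show ?case
    using rule_fact_holds[OF r(1)] ground_rule_meta[OF r(1)] r
    by (intro common_holds(5)) (auto simp: rep_rule_def)
qed

section \<open>The decided predicates, up to \<open>m_lambda\<close>\<close>

lemma definitely_iff:
  "Pos (Atom m_definitely [rep_lit q]) \<in> W \<longleftrightarrow> q \<in> P_Delta \<Sigma> D"
  "Neg (Atom m_definitely [rep_lit q]) \<in> W \<longleftrightarrow> q \<notin> P_Delta \<Sigma> D"
  by (rule wf_model_total; erule definitely_holds definitely_fails)+

text \<open>The \<open>m_neg\<close> facts exist only for predicates of \<open>D\<close>, whence the
  restriction to ground literals of \<open>D\<close>.\<close>

lemma neg_rep_lit_iff:
  assumes "q \<in> ground_literals \<Sigma> D"
  shows "Pos (Atom m_neg [rep_lit q, x]) \<in> W \<longleftrightarrow> x = rep_lit (complement q)"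
    "Pos (Atom m_neg [x, rep_lit q]) \<in> W \<longleftrightarrow> x = rep_lit (complement q)"
  by (rule wf_model_total(1); use neg_holds[of q] neg_holds[of "complement q"] assms
      neg_fails[of "rep_lit q" q x] neg_fails[of x q "rep_lit q"] in simp)+

lemma strict_or_defeasible_iff:
  "Pos (Atom m_strict_or_defeasible ts) \<in> W \<longleftrightarrow>
     (\<exists>r\<in>ground_rules \<Sigma> D. kind r \<noteq> Defeater \<and>
       ts = [rep_label (label r), rep_lit (concl r), mlist (map rep_lit (ante r))])"
  by (rule wf_model_total(1)) (use strict_or_defeasible_holds strict_or_defeasible_fails in auto)

lemma sup_iff:
  "Pos (Atom m_sup ts) \<in> W \<longleftrightarrow>
     (\<exists>r s. (r, s) \<in> superior D \<and> ts = [rep_label r, rep_label s])"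
  by (rule wf_model_total(1)) (use sup_holds sup_fails in auto)

lemma Rsd_for_iff:
  "r \<in> Rsd_for \<Sigma> D q \<longleftrightarrow> r \<in> ground_rules \<Sigma> D \<and> kind r \<noteq> Defeater \<and> concl r = q"
  by (cases "kind r") (auto simp: Rsd_for_def R_for_def)

text \<open>As for \<open>m_definitely\<close>, cycles force a joint unfounded set. The negative
  body literal does no harm because it is already decided: either it is false, or the complement is
  outside \<open>P_Delta\<close>, and then every applicable kind of rule must have an antecedent
  outside \<open>P_lambda\<close>.\<close>

lemma lambda_unfounded:
  defines "A \<equiv> {Atom m_lambda [rep_lit q] | q. q \<notin> P_lambda \<Sigma> D} \<union>
    {Atom m_loop_lambda [mlist (map rep_lit qs)] | qs. \<not> set qs \<subseteq> P_lambda \<Sigma> D}"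
  shows "unfounded ground_program W A"
  unfolding unfounded_def
proof (intro ballI impI)
  fix c
  assume c: "c \<in> ground_program" "head c \<in> A"
  then consider
      q where "head c = Atom m_lambda [rep_lit q]" "q \<notin> P_lambda \<Sigma> D"
    | qs where "head c = Atom m_loop_lambda [mlist (map rep_lit qs)]"
        "\<not> set qs \<subseteq> P_lambda \<Sigma> D"
    by (auto simp: A_def)
  then show "(\<exists>l\<in>set (body c). complement l \<in> W) \<or> (\<exists>a\<in>A. Pos a \<in> set (body c))"
  proof cases
    case 1
    from lambda_clause[OF c(1) 1(1)] obtain x' r y where
      "body c = [Pos (Atom m_definitely [rep_lit q])] \<or>
       body c = [Pos (Atom m_neg [rep_lit q, x']), Neg (Atom m_definitely [x']),
         Pos (Atom m_strict_or_defeasible [r, rep_lit q, y]), Pos (Atom m_loop_lambda [y])]"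
      by auto
    then show ?thesis
    proof
      assume "body c = [Pos (Atom m_definitely [rep_lit q])]"
      moreover have "q \<notin> P_Delta \<Sigma> D"
        using 1(2) by (auto intro: P_lambda.intros)
      ultimately show ?thesis
        using definitely_fails by simp
    next
      assume b: "body c = [Pos (Atom m_neg [rep_lit q, x']), Neg (Atom m_definitely [x']),
         Pos (Atom m_strict_or_defeasible [r, rep_lit q, y]), Pos (Atom m_loop_lambda [y])]"
      show ?thesis
      proof (rule ccontr)
        assume nt: "\<not> ?thesis"
        then have "x' = rep_lit (complement q)"
          using b neg_fails[of "rep_lit q" q x'] by auto
        then have q: "complement q \<notin> P_Delta \<Sigma> D"
          using nt b definitely_holds by auto
        from nt b obtain s where s: "s \<in> ground_rules \<Sigma> D" "kind s \<noteq> Defeater" "concl s = q"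
          "y = mlist (map rep_lit (ante s))"
          using strict_or_defeasible_fails[of "[r, rep_lit q, y]"] by auto
        then have "\<not> set (ante s) \<subseteq> P_lambda \<Sigma> D"
          using 1(2) q P_lambda.intros(2)[of s \<Sigma> D q]
          by (auto simp: Rsd_for_iff antecedent_def)
        then have "Atom m_loop_lambda [y] \<in> A"
          using s(4) by (auto simp: A_def)
        with nt b show False
          by auto
      qed
    qed
  next
    case 2
    obtain q qs' where qs: "qs = q # qs'"
      using 2(2) by (cases qs) auto
    with loop_clause[OF c(1) 2(1), of m_lambda]
    have "body c = [Pos (Atom m_lambda [rep_lit q]),
        Pos (Atom m_loop_lambda [mlist (map rep_lit qs')])]"
      by auto
    moreover have "Atom m_lambda [rep_lit q] \<in> A \<or>
        Atom m_loop_lambda [mlist (map rep_lit qs')] \<in> A"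
      using 2(2) qs by (auto simp: A_def)
    ultimately show ?thesis
      by auto
  qed
qed

lemma lambda_holds: "q \<in> P_lambda \<Sigma> D \<Longrightarrow> Pos (Atom m_lambda [rep_lit q]) \<in> W"
proof (induction rule: P_lambda.induct)
  case (1 q)
  then show ?case
    using definitely_holds P_Delta_ground[OF dtheory]
    by (intro common_holds(6)) (auto intro: rep_lit_meta)
next
  case (2 r q)
  then have r: "r \<in> ground_rules \<Sigma> D" "kind r \<noteq> Defeater" "concl r = q"
    by (auto simp: Rsd_for_iff)
  then have q: "q \<in> ground_literals \<Sigma> D"
    using ground_rule_literals(1)[OF dtheory] by blast
  have "Pos (Atom m_loop_lambda [mlist (map rep_lit (ante r))]) \<in> W"
    by (rule loop_holds[of _ m_lambda])
      (use 2 ground_rule_literals(2)[OF dtheory r(1)] in \<open>auto simp: antecedent_def\<close>)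
  then show ?case
    using strict_or_defeasible_holds[OF r(1,2)] ground_rule_meta[OF r(1)] r(3)
      neg_holds[OF q] definitely_fails[OF "2.hyps"(2)] rep_lit_meta[of "complement q" \<Sigma> D] q
    by (intro common_holds(7)[where x' = "rep_lit (complement q)"]) auto
qed

text \<open>Both truth values are needed later: a false list discards an attacker in the
  completeness proofs, and a true one makes an attacker count in the soundness proofs.\<close>

lemma loop_lambda_iff:
  assumes "set qs \<subseteq> ground_literals \<Sigma> D"
  shows "Pos (Atom m_loop_lambda [mlist (map rep_lit qs)]) \<in> W \<longleftrightarrow> set qs \<subseteq> P_lambda \<Sigma> D"
    "Neg (Atom m_loop_lambda [mlist (map rep_lit qs)]) \<in> W \<longleftrightarrow> \<not> set qs \<subseteq> P_lambda \<Sigma> D"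
proof -
  let ?a = "Atom m_loop_lambda [mlist (map rep_lit qs)]"
  have holds: "Pos ?a \<in> W" if "set qs \<subseteq> P_lambda \<Sigma> D"
    by (rule loop_holds[of _ m_lambda]) (use that assms lambda_holds in auto)
  have fails: "Neg ?a \<in> W" if "\<not> set qs \<subseteq> P_lambda \<Sigma> D"
    by (rule wf_model_NegI[OF lambda_unfounded]) (use that in blast)
  show "Pos ?a \<in> W \<longleftrightarrow> set qs \<subseteq> P_lambda \<Sigma> D"
    "Neg ?a \<in> W \<longleftrightarrow> \<not> set qs \<subseteq> P_lambda \<Sigma> D"
    by (rule wf_model_total; erule holds fails)+
qed

end

section \<open>Defeasible conclusions\<close>

lemma metaprogram_par_locale:
  "defeasible_theory \<Sigma> D \<Longrightarrow> metaprogram \<Sigma> D (metaprogram_par D)"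
  by unfold_locales (auto simp: metaprogram_par_def)

context
  fixes \<Sigma> :: "('f \<times> nat) set"
    and D :: "('p, 'f, 'v, 'l) dtheory"
  assumes D: "defeasible_theory \<Sigma> D"
begin

interpretation metaprogram \<Sigma> D "metaprogram_par D"
  using D by (rule metaprogram_par_locale)

lemma par_defeasibly_clause:
  assumes "c \<in> ground_program" "head c = Atom m_defeasibly ts"
  shows "\<exists>x x' r y. ts = [x] \<and> (body c = [Pos (Atom m_definitely [x])] \<or>
    body c = [Pos (Atom m_neg [x, x']), Neg (Atom m_definitely [x']),
      Pos (Atom m_strict_or_defeasible [r, x, y]), Pos (Atom m_loop_defeasibly [y]),
      Neg (Atom m_overruled [x])])"
  using assms
  by (auto simp: ground_clauses_def metaprogram_par_def program_defs rep_rule_def)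

lemma par_overruled_clause:
  assumes "c \<in> ground_program" "head c = Atom m_overruled ts"
  shows "\<exists>x x' s u. ts = [x] \<and> body c = [Pos (Atom m_neg [x, x']),
      Pos (Atom m_rule [s, x', u]), Pos (Atom m_loop_lambda [u]),
      Neg (Atom m_defeated [s, x'])]"
  using assms
  by (auto simp: ground_clauses_def metaprogram_par_def program_defs rep_rule_def)

lemma par_defeated_clause:
  assumes "c \<in> ground_program" "head c = Atom m_defeated ts"
  shows "\<exists>x x' s t v. ts = [s, x'] \<and> body c = [Pos (Atom m_neg [x, x']),
      Pos (Atom m_sup [t, s]), Pos (Atom m_strict_or_defeasible [t, x, v]),
      Pos (Atom m_loop_defeasibly [v])]"
  using assms
  by (auto simp: ground_clauses_def metaprogram_par_def program_defs rep_rule_def)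

lemma metaprogram_par_rules:
  "(Atom m_defeasibly [Var VX] :-
        [Pos (Atom m_neg [Var VX, Var VX']),
         Neg (Atom m_definitely [Var VX']),
         Pos (Atom m_strict_or_defeasible [Var VR, Var VX, Var VY]),
         Pos (Atom m_loop_defeasibly [Var VY]),
         Neg (Atom m_overruled [Var VX])]) \<in> metaprogram_par D"
  "(Atom m_overruled [Var VX] :-
        [Pos (Atom m_neg [Var VX, Var VX']),
         Pos (Atom m_rule [Var VS, Var VX', Var VU]),
         Pos (Atom m_loop_lambda [Var VU]),
         Neg (Atom m_defeated [Var VS, Var VX'])]) \<in> metaprogram_par D"
  "(Atom m_defeated [Var VS, Var VX'] :-
        [Pos (Atom m_neg [Var VX, Var VX']),
         Pos (Atom m_sup [Var VT, Var VS]),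
         Pos (Atom m_strict_or_defeasible [Var VT, Var VX, Var VV]),
         Pos (Atom m_loop_defeasibly [Var VV])]) \<in> metaprogram_par D"
  by (simp_all add: metaprogram_par_def)

text \<open>The soundness proof confronts an unfounded set with this clause, so membership of the
  clause is needed rather than the truth of its head.\<close>

lemma par_overruled_instance:
  assumes "{x, x', s, u} \<subseteq> HU"
  shows "Clause (Atom m_overruled [x]) [Pos (Atom m_neg [x, x']),
      Pos (Atom m_rule [s, x', u]), Pos (Atom m_loop_lambda [u]),
      Neg (Atom m_defeated [s, x'])] \<in> ground_program"
proof -
  let ?\<sigma> = "(\<lambda>_. x)(VX' := x', VS := s, VU := u)"
  from ground_clausesI[OF metaprogram_par_rules(2), of ?\<sigma> "meta_universe \<Sigma> D"] assms
  show ?thesis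
    by (force simp: vars_clause_def)
qed

lemma par_defeasibly_holds:
  assumes "{r, x, x', y} \<subseteq> HU" "Pos (Atom m_neg [x, x']) \<in> W"
    "Neg (Atom m_definitely [x']) \<in> W" "Pos (Atom m_strict_or_defeasible [r, x, y]) \<in> W"
    "Pos (Atom m_loop_defeasibly [y]) \<in> W" "Neg (Atom m_overruled [x]) \<in> W"
  shows "Pos (Atom m_defeasibly [x]) \<in> W"
  using assms
    instanceI[OF metaprogram_par_rules(1), of "(\<lambda>_. r)(VX := x, VX' := x', VY := y)"]
  by (auto simp: vars_clause_def)

lemma par_defeated_holds:
  assumes "{s, x, x', t, v} \<subseteq> HU" "Pos (Atom m_neg [x, x']) \<in> W"
    "Pos (Atom m_sup [t, s]) \<in> W" "Pos (Atom m_strict_or_defeasible [t, x, v]) \<in> W"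
    "Pos (Atom m_loop_defeasibly [v]) \<in> W"
  shows "Pos (Atom m_defeated [s, x']) \<in> W"
  using assms
    instanceI[OF metaprogram_par_rules(3), of "(\<lambda>_. s)(VX := x, VX' := x', VT := t, VV := v)"]
  by (auto simp: vars_clause_def)

lemma par_complete: "q \<in> P_par \<Sigma> D \<Longrightarrow> Pos (Atom m_defeasibly [rep_lit q]) \<in> W"
proof (induction rule: P_par.induct)
  case (1 q)
  then show ?case
    using definitely_holds P_Delta_ground[OF D] by (intro common_holds(8)) (auto intro: rep_lit_meta)
next
  case (2 r q)
  have loop: "Pos (Atom m_loop_defeasibly [mlist (map rep_lit (ante t))]) \<in> W"
    if "t \<in> ground_rules \<Sigma> D" "\<forall>a\<in>antecedent t. Pos (Atom m_defeasibly [rep_lit a]) \<in> W" for t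
    by (rule loop_holds[of _ m_defeasibly])
      (use that ground_rule_literals(2)[OF D that(1)] in \<open>auto simp: antecedent_def\<close>)
  from 2 have r: "r \<in> ground_rules \<Sigma> D" "kind r \<noteq> Defeater" "concl r = q"
    by (auto simp: Rsd_for_iff)
  then have q: "q \<in> ground_literals \<Sigma> D"
    using ground_rule_literals(1)[OF D] by blast
  have "Neg (Atom m_overruled [rep_lit q]) \<in> W"
  proof (rule wf_model_NegI1)
    fix c
    assume c: "c \<in> ground_program" "head c = Atom m_overruled [rep_lit q]"
    from par_overruled_clause[OF this] obtain x' l u where
      b: "body c = [Pos (Atom m_neg [rep_lit q, x']), Pos (Atom m_rule [l, x', u]),
        Pos (Atom m_loop_lambda [u]), Neg (Atom m_defeated [l, x'])]"
      by auto
    show "\<exists>k\<in>set (body c). complement k \<in> W"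
    \<comment> \<open>A body without a false literal must come from an actual rule \<open>s\<close>
      for the complement of \<open>q\<close> with all antecedents in
      \<open>P_lambda\<close>.\<close>
    proof (rule ccontr)
      assume nt: "\<not> ?thesis"
      then have x': "x' = rep_lit (complement q)"
        using b neg_fails[of "rep_lit q" q x'] by auto
      from nt b obtain s where s: "s \<in> ground_rules \<Sigma> D" "l = rep_label (label s)"
        "x' = rep_lit (concl s)" "u = mlist (map rep_lit (ante s))"
        using rule_fails[of "[l, x', u]"] by auto
      then have "set (ante s) \<subseteq> P_lambda \<Sigma> D"
        using nt b loop_lambda_iff(2)[of "ante s"] ground_rule_literals(2)[OF D s(1)]
        by (auto simp: antecedent_def)
      moreover have "s \<in> R_for \<Sigma> D (complement q)"
        using s x' by (auto simp: R_for_def)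
      \<comment> \<open>Against an applicable attacker the attack condition leaves only a superior
        rule \<open>t\<close>. Its antecedents are true by the induction hypothesis, so
        \<open>m_defeated\<close> holds and the last body literal is false after all.\<close>
      ultimately obtain t where t: "t \<in> Rsd_for \<Sigma> D q" "(label t, label s) \<in> superior D"
        "\<forall>a\<in>antecedent t. Pos (Atom m_defeasibly [rep_lit a]) \<in> W"
        using 2 by (auto simp: antecedent_def)
      have "Pos (Atom m_defeated [l, x']) \<in> W"
      proof (rule par_defeated_holds)
        have t': "t \<in> ground_rules \<Sigma> D" "kind t \<noteq> Defeater" "concl t = q"
          using t(1) by (auto simp: Rsd_for_iff)
        show "{l, rep_lit q, x', rep_label (label t), mlist (map rep_lit (ante t))} \<subseteq> HU"
          using ground_rule_meta[OF s(1)] ground_rule_meta[OF t'(1)] s t' by auto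
        show "Pos (Atom m_strict_or_defeasible
            [rep_label (label t), rep_lit q, mlist (map rep_lit (ante t))]) \<in> W"
          using strict_or_defeasible_holds[OF t'(1,2)] t'(3) by simp
        show "Pos (Atom m_loop_defeasibly [mlist (map rep_lit (ante t))]) \<in> W"
          using loop t' t(3) by blast
      qed (use neg_holds[OF q] x' sup_holds[OF t(2)] s(2) in auto)
      with nt b show False
        by auto
    qed
  qed
  moreover have "Neg (Atom m_definitely [rep_lit (complement q)]) \<in> W"
    using 2 definitely_fails by blast
  moreover have "Pos (Atom m_loop_defeasibly [mlist (map rep_lit (ante r))]) \<in> W"
    using loop r 2 by blast
  ultimately show ?case
    using strict_or_defeasible_holds[OF r(1,2)] ground_rule_meta[OF r(1)] r(3)
      neg_holds[OF q] rep_lit_meta[of "complement q" \<Sigma> D] q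
    by (intro par_defeasibly_holds[where x' = "rep_lit (complement q)"]) auto
qed

text \<open>The attack condition from the second rule of \<open>P_par\<close>, taken at the finished
  set. It is the meaning given to a false \<open>m_overruled\<close> atom and does not refer to a
  particular supporting rule.\<close>

definition par_unbeaten :: "('p, 'f, 'v) atom literal \<Rightarrow> bool" where
  "par_unbeaten q \<longleftrightarrow> (\<forall>s\<in>R_for \<Sigma> D (complement q).
     (\<exists>a\<in>antecedent s. a \<notin> P_lambda \<Sigma> D) \<or>
     (\<exists>t\<in>Rsd_for \<Sigma> D q. (\<forall>a\<in>antecedent t. a \<in> P_par \<Sigma> D) \<and>
       (label t, label s) \<in> superior D))"

text \<open>An invariant of the fixpoint iteration. It is one-sided since the model may be partial
  here: nothing is claimed for false \<open>m_defeasibly\<close> or true \<open>m_overruled\<close>.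
  Atoms whose arguments are not encodings are left unconstrained.\<close>

fun par_sound :: "('p, 'f, 'v, 'l) matom literal \<Rightarrow> bool" where
  "par_sound (Pos (Atom pr ts)) \<longleftrightarrow>
     (pr = m_defeasibly \<longrightarrow> (\<forall>q. ts = [rep_lit q] \<longrightarrow> q \<in> P_par \<Sigma> D)) \<and>
     (pr = m_loop_defeasibly \<longrightarrow>
        (\<forall>qs. ts = [mlist (map rep_lit qs)] \<longrightarrow> set qs \<subseteq> P_par \<Sigma> D)) \<and>
     (pr = m_defeated \<longrightarrow> (\<forall>l q. ts = [rep_label l, rep_lit (complement q)] \<longrightarrow>
        (\<exists>t\<in>Rsd_for \<Sigma> D q. (\<forall>a\<in>antecedent t. a \<in> P_par \<Sigma> D) \<and> (label t, l) \<in> superior D)))"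
| "par_sound (Neg (Atom pr ts)) \<longleftrightarrow>
     (pr = m_overruled \<longrightarrow> (\<forall>q. ts = [rep_lit q] \<longrightarrow> par_unbeaten q))"

lemma wf_model_par_sound: "k \<in> W \<Longrightarrow> par_sound k"
proof (induction rule: wf_model_induct)
  case (Pos c J)
  \<comment> \<open>The decided predicates are evaluated in the full model \<open>W\<close>; for the
    predicates of the upper level the induction hypothesis on \<open>J\<close> is used.\<close>
  have bodyW: "set (body c) \<subseteq> W" and bodyS: "\<forall>k\<in>set (body c). par_sound k"
    using Pos by blast+
  have "q \<in> P_par \<Sigma> D" if h: "head c = Atom m_defeasibly [rep_lit q]" for q
  proof -
    from par_defeasibly_clause[OF Pos(1) h] obtain x' r y where
      "body c = [Pos (Atom m_definitely [rep_lit q])] \<or>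
       body c = [Pos (Atom m_neg [rep_lit q, x']), Neg (Atom m_definitely [x']),
         Pos (Atom m_strict_or_defeasible [r, rep_lit q, y]), Pos (Atom m_loop_defeasibly [y]),
         Neg (Atom m_overruled [rep_lit q])]"
      by auto
    then show ?thesis
    proof
      assume "body c = [Pos (Atom m_definitely [rep_lit q])]"
      then have "q \<in> P_Delta \<Sigma> D"
        using bodyW by (simp add: definitely_iff)
      then show ?thesis
        by (rule P_par.intros)
    next
      assume b: "body c = [Pos (Atom m_neg [rep_lit q, x']), Neg (Atom m_definitely [x']),
         Pos (Atom m_strict_or_defeasible [r, rep_lit q, y]), Pos (Atom m_loop_defeasibly [y]),
         Neg (Atom m_overruled [rep_lit q])]"
      then obtain s where s: "s \<in> Rsd_for \<Sigma> D q" "y = mlist (map rep_lit (ante s))"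
        using bodyW by (auto simp: strict_or_defeasible_iff Rsd_for_iff)
      then have "q \<in> ground_literals \<Sigma> D"
        using ground_rule_literals(1)[OF D] by (auto simp: Rsd_for_iff)
      then have "complement q \<notin> P_Delta \<Sigma> D"
        using bodyW b by (auto simp: neg_rep_lit_iff definitely_iff)
      moreover have "\<forall>a\<in>antecedent s. a \<in> P_par \<Sigma> D"
        using bodyS b s(2) by (auto simp: antecedent_def)
      moreover have "par_unbeaten q"
        using bodyS b by auto
      ultimately show ?thesis
        using s(1) P_par.intros(2) unfolding par_unbeaten_def by blast
    qed
  qed
  moreover have "set qs \<subseteq> P_par \<Sigma> D"
    if h: "head c = Atom m_loop_defeasibly [mlist (map rep_lit qs)]" for qs
  proof (cases qs)
    case (Cons q qs')
    with loop_clause[OF Pos(1) h, of m_defeasibly]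
    have "body c = [Pos (Atom m_defeasibly [rep_lit q]),
        Pos (Atom m_loop_defeasibly [mlist (map rep_lit qs')])]"
      by auto
    then show ?thesis
      using bodyS Cons by auto
  qed simp
  moreover have
    "\<exists>t\<in>Rsd_for \<Sigma> D q. (\<forall>a\<in>antecedent t. a \<in> P_par \<Sigma> D) \<and> (label t, l) \<in> superior D"
    if h: "head c = Atom m_defeated [rep_label l, rep_lit (complement q)]" for l q
  proof -
    from par_defeated_clause[OF Pos(1) h] obtain x l' v where
      b: "body c = [Pos (Atom m_neg [x, rep_lit (complement q)]), Pos (Atom m_sup [l', rep_label l]),
        Pos (Atom m_strict_or_defeasible [l', x, v]), Pos (Atom m_loop_defeasibly [v])]"
      by auto
    \<comment> \<open>The \<open>m_sup\<close> fact relates labels only. The rule instance with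
      label \<open>l'\<close> comes from the third body atom, and the \<open>m_neg\<close> atom
      identifies its conclusion as \<open>q\<close>.\<close>
    obtain t where t: "t \<in> ground_rules \<Sigma> D" "kind t \<noteq> Defeater" "x = rep_lit (concl t)"
      "l' = rep_label (label t)" "v = mlist (map rep_lit (ante t))"
      using b bodyW by (auto simp: strict_or_defeasible_iff)
    then have "Pos (Atom m_neg [rep_lit (concl t), rep_lit (complement q)]) \<in> W"
      using b bodyW by auto
    then have "complement q = complement (concl t)"
      using ground_rule_literals(1)[OF D t(1)] by (simp add: neg_rep_lit_iff)
    then have "concl t = q"
      by (metis complement_complement)
    moreover have "(label t, l) \<in> superior D"
      using b bodyW t by (auto simp: sup_iff)
    moreover have "\<forall>a\<in>antecedent t. a \<in> P_par \<Sigma> D"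
      using bodyS b t by (auto simp: antecedent_def)
    ultimately show ?thesis
      using t by (auto simp: Rsd_for_iff)
  qed
  ultimately show ?case
    by (cases "head c") auto
next
  case (Neg a A J)
  have "par_unbeaten q" if a: "a = Atom m_overruled [rep_lit q]" for q
    unfolding par_unbeaten_def
  proof (intro ballI)
    fix s
    assume "s \<in> R_for \<Sigma> D (complement q)"
    then have s: "s \<in> ground_rules \<Sigma> D" "concl s = complement q"
      by (auto simp: R_for_def)
    then have q: "q \<in> ground_literals \<Sigma> D"
      using ground_rule_literals(1)[OF D s(1)] by simp
    show "(\<exists>a\<in>antecedent s. a \<notin> P_lambda \<Sigma> D) \<or>
      (\<exists>t\<in>Rsd_for \<Sigma> D q. (\<forall>a\<in>antecedent t. a \<in> P_par \<Sigma> D) \<and>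
       (label t, label s) \<in> superior D)"
    proof (subst disj_imp, rule impI)
      assume "\<not> (\<exists>a\<in>antecedent s. a \<notin> P_lambda \<Sigma> D)"
      then have lam: "set (ante s) \<subseteq> P_lambda \<Sigma> D"
        by (auto simp: antecedent_def)
      define x' u l where "x' = (rep_lit (complement q) :: ('p, 'f, 'v, 'l) mtrm)"
        and "u = (mlist (map rep_lit (ante s)) :: ('p, 'f, 'v, 'l) mtrm)"
        and "l = (rep_label (label s) :: ('p, 'f, 'v, 'l) mtrm)"
      \<comment> \<open>The body of the clause instance that lets the attacker \<open>s\<close>
        overrule \<open>q\<close>; its head is the unfounded atom \<open>a\<close>.\<close>
      let ?b = "[Pos (Atom m_neg [rep_lit q, x']), Pos (Atom m_rule [l, x', u]),
        Pos (Atom m_loop_lambda [u]), Neg (Atom m_defeated [l, x'])]"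
      have "{rep_lit q, x', l, u} \<subseteq> HU"
        using ground_rule_meta[OF s(1)] rep_lit_meta[OF q] s(2) by (auto simp: x'_def u_def l_def)
      then have "Clause a ?b \<in> ground_program"
        unfolding a by (rule par_overruled_instance)
      then have "(\<exists>k\<in>set ?b. complement k \<in> J) \<or> (\<exists>d\<in>A. Pos d \<in> set ?b)"
        using Neg.hyps(1) \<open>a \<in> A\<close> unfolding unfounded_def by fastforce
      moreover have pos: "Pos (Atom m_neg [rep_lit q, x']) \<in> W" "Pos (Atom m_rule [l, x', u]) \<in> W"
        "Pos (Atom m_loop_lambda [u]) \<in> W"
        using neg_holds[OF q] rule_holds[OF s(1)] s(2) lam
          loop_lambda_iff(1)[of "ante s"] ground_rule_literals(2)[OF D s(1)]
        by (auto simp: x'_def u_def l_def antecedent_def)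
      moreover have "Neg d \<in> W" if "d \<in> A" for d
        using Neg that by blast
      moreover have "J \<subseteq> W"
        using Neg by blast
      \<comment> \<open>The three positive literals are true in \<open>W\<close>, so by consistency
        none of them is false in \<open>J\<close> or in \<open>A\<close>, whose members are all
        false in \<open>W\<close>. Only the negative literal can block the clause, and its
        complement lies in \<open>J\<close>, where the induction hypothesis applies.\<close>
      ultimately have "Pos (Atom m_defeated [l, x']) \<in> J"
        using pos[THEN wf_model_not_both] by auto
      then show "\<exists>t\<in>Rsd_for \<Sigma> D q. (\<forall>a\<in>antecedent t. a \<in> P_par \<Sigma> D) \<and>
          (label t, label s) \<in> superior D"
        using Neg.IH by (fastforce simp: l_def x'_def)
    qed
  qed
  then show ?case
    by (cases a) auto
qed

lemma par_correct:
  "q \<in> P_par \<Sigma> D \<longleftrightarrow> wf_entails (meta_universe \<Sigma> D) (metaprogram_par D)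
     (Pos (Atom m_defeasibly [rep_lit q]))"
  using par_complete[of q] wf_model_par_sound[of "Pos (Atom m_defeasibly [rep_lit q])"]
  by (auto simp: wf_entails_def)

end

section \<open>Correctness of the program for \<open>P_par_star\<close>\<close>

lemma metaprogram_par_star_locale:
  "defeasible_theory \<Sigma> D \<Longrightarrow> metaprogram \<Sigma> D (metaprogram_par_star D)"
  by unfold_locales (auto simp: metaprogram_par_star_def)

context
  fixes \<Sigma> :: "('f \<times> nat) set"
    and D :: "('p, 'f, 'v, 'l) dtheory"
  assumes D: "defeasible_theory \<Sigma> D"
begin

interpretation metaprogram \<Sigma> D "metaprogram_par_star D"
  using D by (rule metaprogram_par_star_locale)

lemma par_star_defeasibly_clause:
  assumes "c \<in> ground_program" "head c = Atom m_defeasibly ts"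
  shows "\<exists>x x' r y. ts = [x] \<and> (body c = [Pos (Atom m_definitely [x])] \<or>
    body c = [Pos (Atom m_neg [x, x']), Neg (Atom m_definitely [x']),
      Pos (Atom m_strict_or_defeasible [r, x, y]), Pos (Atom m_loop_defeasibly [y]),
      Neg (Atom m_overruled [r, x])])"
  using assms
  by (auto simp: ground_clauses_def metaprogram_par_star_def program_defs rep_rule_def)

lemma par_star_overruled_clause:
  assumes "c \<in> ground_program" "head c = Atom m_overruled ts"
  shows "\<exists>r x x' s u. ts = [r, x] \<and> body c = [Pos (Atom m_neg [x, x']),
      Pos (Atom m_rule [s, x', u]), Pos (Atom m_loop_lambda [u]),
      Neg (Atom m_defeats [r, s])]"
  using assms
  by (auto simp: ground_clauses_def metaprogram_par_star_def program_defs rep_rule_def)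

lemma par_star_defeats_clause:
  assumes "c \<in> ground_program" "head c = Atom m_defeats ts"
  shows "body c = [Pos (Atom m_sup ts)]"
  using assms
  by (auto simp: ground_clauses_def metaprogram_par_star_def program_defs rep_rule_def)

lemma metaprogram_par_star_rules:
  "(Atom m_defeasibly [Var VX] :-
        [Pos (Atom m_neg [Var VX, Var VX']),
         Neg (Atom m_definitely [Var VX']),
         Pos (Atom m_strict_or_defeasible [Var VR, Var VX, Var VY]),
         Pos (Atom m_loop_defeasibly [Var VY]),
         Neg (Atom m_overruled [Var VR, Var VX])]) \<in> metaprogram_par_star D"
  "(Atom m_overruled [Var VR, Var VX] :-
        [Pos (Atom m_neg [Var VX, Var VX']),
         Pos (Atom m_rule [Var VS, Var VX', Var VU]),
         Pos (Atom m_loop_lambda [Var VU]),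
         Neg (Atom m_defeats [Var VR, Var VS])]) \<in> metaprogram_par_star D"
  "(Atom m_defeats [Var VR, Var VS] :- [Pos (Atom m_sup [Var VR, Var VS])])
     \<in> metaprogram_par_star D"
  by (simp_all add: metaprogram_par_star_def)

lemma par_star_overruled_instance:
  assumes "{r, x, x', s, u} \<subseteq> HU"
  shows "Clause (Atom m_overruled [r, x]) [Pos (Atom m_neg [x, x']),
      Pos (Atom m_rule [s, x', u]), Pos (Atom m_loop_lambda [u]),
      Neg (Atom m_defeats [r, s])] \<in> ground_program"
proof -
  let ?\<sigma> = "(\<lambda>_. x)(VR := r, VX' := x', VS := s, VU := u)"
  from ground_clausesI[OF metaprogram_par_star_rules(2), of ?\<sigma> "meta_universe \<Sigma> D"] assms
  show ?thesis
    by (force simp: vars_clause_def)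
qed

lemma par_star_defeasibly_holds:
  assumes "{r, x, x', y} \<subseteq> HU" "Pos (Atom m_neg [x, x']) \<in> W"
    "Neg (Atom m_definitely [x']) \<in> W" "Pos (Atom m_strict_or_defeasible [r, x, y]) \<in> W"
    "Pos (Atom m_loop_defeasibly [y]) \<in> W" "Neg (Atom m_overruled [r, x]) \<in> W"
  shows "Pos (Atom m_defeasibly [x]) \<in> W"
  using assms
    instanceI[OF metaprogram_par_star_rules(1), of "(\<lambda>_. r)(VX := x, VX' := x', VY := y)"]
  by (auto simp: vars_clause_def)

text \<open>\<open>m_defeats\<close> merely copies \<open>m_sup\<close> and is therefore decided; no
  cycle through negation arises in this program. The assumption makes the labels available for
  instantiation.\<close>

lemma par_star_defeats_iff:
  assumes "{rep_label r, rep_label s :: ('p, 'f, 'v, 'l) mtrm} \<subseteq> HU"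
  shows "Pos (Atom m_defeats [rep_label r, rep_label s]) \<in> W \<longleftrightarrow> (r, s) \<in> superior D"
    "Neg (Atom m_defeats [rep_label r, rep_label s]) \<in> W \<longleftrightarrow> (r, s) \<notin> superior D"
proof -
  let ?a = "Atom m_defeats [rep_label r, rep_label s]"
  have holds: "Pos ?a \<in> W" if "(r, s) \<in> superior D"
    using assms sup_holds[OF that]
      instanceI[OF metaprogram_par_star_rules(3), of "(\<lambda>_. rep_label r)(VS := rep_label s)"]
    by (auto simp: vars_clause_def)
  have fails: "Neg ?a \<in> W" if "(r, s) \<notin> superior D"
  proof (rule wf_model_NegI1)
    fix c
    assume "c \<in> ground_program" "head c = ?a"
    from par_star_defeats_clause[OF this] show "\<exists>l\<in>set (body c). complement l \<in> W"
      using sup_fails[of "[rep_label r, rep_label s]"] that by auto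
  qed
  show "Pos ?a \<in> W \<longleftrightarrow> (r, s) \<in> superior D" "Neg ?a \<in> W \<longleftrightarrow> (r, s) \<notin> superior D"
    by (rule wf_model_total; erule holds fails)+
qed

lemma par_star_complete: "q \<in> P_par_star \<Sigma> D \<Longrightarrow> Pos (Atom m_defeasibly [rep_lit q]) \<in> W"
proof (induction rule: P_par_star.induct)
  case (1 q)
  then show ?case
    using definitely_holds P_Delta_ground[OF D] by (intro common_holds(8)) (auto intro: rep_lit_meta)
next
  case (2 r q)
  have loop: "Pos (Atom m_loop_defeasibly [mlist (map rep_lit (ante t))]) \<in> W"
    if "t \<in> ground_rules \<Sigma> D" "\<forall>a\<in>antecedent t. Pos (Atom m_defeasibly [rep_lit a]) \<in> W" for t
    by (rule loop_holds[of _ m_defeasibly])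
      (use that ground_rule_literals(2)[OF D that(1)] in \<open>auto simp: antecedent_def\<close>)
  from 2 have r: "r \<in> ground_rules \<Sigma> D" "kind r \<noteq> Defeater" "concl r = q"
    by (auto simp: Rsd_for_iff)
  then have q: "q \<in> ground_literals \<Sigma> D"
    using ground_rule_literals(1)[OF D] by blast
  \<comment> \<open>The atom carries the label of the supporting rule \<open>r\<close>, since here
    \<open>r\<close> itself must be superior to every applicable attacker.\<close>
  have "Neg (Atom m_overruled [rep_label (label r), rep_lit q]) \<in> W"
  proof (rule wf_model_NegI1)
    fix c
    assume c: "c \<in> ground_program" "head c = Atom m_overruled [rep_label (label r), rep_lit q]"
    from par_star_overruled_clause[OF this] obtain x' l u where
      b: "body c = [Pos (Atom m_neg [rep_lit q, x']), Pos (Atom m_rule [l, x', u]),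
        Pos (Atom m_loop_lambda [u]), Neg (Atom m_defeats [rep_label (label r), l])]"
      by auto
    show "\<exists>k\<in>set (body c). complement k \<in> W"
    proof (rule ccontr)
      assume nt: "\<not> ?thesis"
      then have x': "x' = rep_lit (complement q)"
        using b neg_fails[of "rep_lit q" q x'] by auto
      from nt b obtain s where s: "s \<in> ground_rules \<Sigma> D" "l = rep_label (label s)"
        "x' = rep_lit (concl s)" "u = mlist (map rep_lit (ante s))"
        using rule_fails[of "[l, x', u]"] by auto
      then have "set (ante s) \<subseteq> P_lambda \<Sigma> D"
        using nt b loop_lambda_iff(2)[of "ante s"] ground_rule_literals(2)[OF D s(1)]
        by (auto simp: antecedent_def)
      moreover have "s \<in> R_for \<Sigma> D (complement q)"
        using s x' by (auto simp: R_for_def)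
      ultimately have "(label r, label s) \<in> superior D"
        using 2 by (auto simp: antecedent_def)
      then have "Pos (Atom m_defeats [rep_label (label r), l]) \<in> W"
        using ground_rule_meta[OF s(1)] ground_rule_meta[OF r(1)] s(2)
        by (simp add: par_star_defeats_iff)
      with nt b show False
        by auto
    qed
  qed
  moreover have "Neg (Atom m_definitely [rep_lit (complement q)]) \<in> W"
    using 2 definitely_fails by blast
  moreover have "Pos (Atom m_loop_defeasibly [mlist (map rep_lit (ante r))]) \<in> W"
    using loop r 2 by blast
  ultimately show ?case
    using strict_or_defeasible_holds[OF r(1,2)] ground_rule_meta[OF r(1)] r(3)
      neg_holds[OF q] rep_lit_meta[of "complement q" \<Sigma> D] q
    by (intro par_star_defeasibly_holds[where x' = "rep_lit (complement q)"]) auto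
qed

text \<open>The supporting rule enters only through its label, which is all that an
  \<open>m_overruled\<close> atom records; different instances of one rule with conclusion
  \<open>q\<close> thus share the condition.\<close>

definition par_star_unbeaten :: "'l \<Rightarrow> ('p, 'f, 'v) atom literal \<Rightarrow> bool" where
  "par_star_unbeaten l q \<longleftrightarrow> (\<forall>s\<in>R_for \<Sigma> D (complement q).
     (\<exists>a\<in>antecedent s. a \<notin> P_lambda \<Sigma> D) \<or> (l, label s) \<in> superior D)"

text \<open>\<open>m_defeats\<close> needs no invariant, being decided. For
  \<open>m_overruled\<close> the labels are those of ground rules, which ensures that they belong to
  the Herbrand universe and that the attacking clause instance exists.\<close>

fun par_star_sound :: "('p, 'f, 'v, 'l) matom literal \<Rightarrow> bool" where
  "par_star_sound (Pos (Atom pr ts)) \<longleftrightarrow>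
     (pr = m_defeasibly \<longrightarrow> (\<forall>q. ts = [rep_lit q] \<longrightarrow> q \<in> P_par_star \<Sigma> D)) \<and>
     (pr = m_loop_defeasibly \<longrightarrow>
        (\<forall>qs. ts = [mlist (map rep_lit qs)] \<longrightarrow> set qs \<subseteq> P_par_star \<Sigma> D))"
| "par_star_sound (Neg (Atom pr ts)) \<longleftrightarrow>
     (pr = m_overruled \<longrightarrow> (\<forall>r\<in>ground_rules \<Sigma> D. \<forall>q.
        ts = [rep_label (label r), rep_lit q] \<longrightarrow> par_star_unbeaten (label r) q))"

lemma wf_model_par_star_sound: "k \<in> W \<Longrightarrow> par_star_sound k"
proof (induction rule: wf_model_induct)
  case (Pos c J)
  have bodyW: "set (body c) \<subseteq> W" and bodyS: "\<forall>k\<in>set (body c). par_star_sound k"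
    using Pos by blast+
  have "q \<in> P_par_star \<Sigma> D" if h: "head c = Atom m_defeasibly [rep_lit q]" for q
  proof -
    from par_star_defeasibly_clause[OF Pos(1) h] obtain x' r y where
      "body c = [Pos (Atom m_definitely [rep_lit q])] \<or>
       body c = [Pos (Atom m_neg [rep_lit q, x']), Neg (Atom m_definitely [x']),
         Pos (Atom m_strict_or_defeasible [r, rep_lit q, y]), Pos (Atom m_loop_defeasibly [y]),
         Neg (Atom m_overruled [r, rep_lit q])]"
      by auto
    then show ?thesis
    proof
      assume "body c = [Pos (Atom m_definitely [rep_lit q])]"
      then have "q \<in> P_Delta \<Sigma> D"
        using bodyW by (simp add: definitely_iff)
      then show ?thesis
        by (rule P_par_star.intros)
    next
      assume b: "body c = [Pos (Atom m_neg [rep_lit q, x']), Neg (Atom m_definitely [x']),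
         Pos (Atom m_strict_or_defeasible [r, rep_lit q, y]), Pos (Atom m_loop_defeasibly [y]),
         Neg (Atom m_overruled [r, rep_lit q])]"
      then obtain s where s: "s \<in> Rsd_for \<Sigma> D q" "r = rep_label (label s)"
        "y = mlist (map rep_lit (ante s))"
        using bodyW by (auto simp: strict_or_defeasible_iff Rsd_for_iff)
      then have "q \<in> ground_literals \<Sigma> D"
        using ground_rule_literals(1)[OF D] by (auto simp: Rsd_for_iff)
      then have "complement q \<notin> P_Delta \<Sigma> D"
        using bodyW b by (auto simp: neg_rep_lit_iff definitely_iff)
      moreover have "\<forall>a\<in>antecedent s. a \<in> P_par_star \<Sigma> D"
        using bodyS b s(3) by (auto simp: antecedent_def)
      \<comment> \<open>The same meta variable occurs in the rule atom and in
        \<open>m_overruled\<close>, so the condition obtained is the one for the supporting rule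
        \<open>s\<close>.\<close>
      moreover have "par_star_unbeaten (label s) q"
        using bodyS b s by (auto simp: Rsd_for_iff)
      ultimately show ?thesis
        using s(1) P_par_star.intros(2) unfolding par_star_unbeaten_def by blast
    qed
  qed
  moreover have "set qs \<subseteq> P_par_star \<Sigma> D"
    if h: "head c = Atom m_loop_defeasibly [mlist (map rep_lit qs)]" for qs
  proof (cases qs)
    case (Cons q qs')
    with loop_clause[OF Pos(1) h, of m_defeasibly]
    have "body c = [Pos (Atom m_defeasibly [rep_lit q]),
        Pos (Atom m_loop_defeasibly [mlist (map rep_lit qs')])]"
      by auto
    then show ?thesis
      using bodyS Cons by auto
  qed simp
  ultimately show ?case
    by (cases "head c") auto
next
  case (Neg a A J)
  have "par_star_unbeaten (label r) q"
    if r: "r \<in> ground_rules \<Sigma> D" and a: "a = Atom m_overruled [rep_label (label r), rep_lit q]"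
    for r q
    unfolding par_star_unbeaten_def
  proof (intro ballI)
    fix s
    assume "s \<in> R_for \<Sigma> D (complement q)"
    then have s: "s \<in> ground_rules \<Sigma> D" "concl s = complement q"
      by (auto simp: R_for_def)
    then have q: "q \<in> ground_literals \<Sigma> D"
      using ground_rule_literals(1)[OF D s(1)] by simp
    show "(\<exists>a\<in>antecedent s. a \<notin> P_lambda \<Sigma> D) \<or> (label r, label s) \<in> superior D"
    proof (subst disj_imp, rule impI)
      assume "\<not> (\<exists>a\<in>antecedent s. a \<notin> P_lambda \<Sigma> D)"
      then have lam: "set (ante s) \<subseteq> P_lambda \<Sigma> D"
        by (auto simp: antecedent_def)
      define x' u l where "x' = (rep_lit (complement q) :: ('p, 'f, 'v, 'l) mtrm)"
        and "u = (mlist (map rep_lit (ante s)) :: ('p, 'f, 'v, 'l) mtrm)"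
        and "l = (rep_label (label s) :: ('p, 'f, 'v, 'l) mtrm)"
      let ?b = "[Pos (Atom m_neg [rep_lit q, x']), Pos (Atom m_rule [l, x', u]),
        Pos (Atom m_loop_lambda [u]), Neg (Atom m_defeats [rep_label (label r), l])]"
      have "{rep_label (label r), rep_lit q, x', l, u} \<subseteq> HU"
        using ground_rule_meta[OF r] ground_rule_meta[OF s(1)] rep_lit_meta[OF q] s(2)
        by (auto simp: x'_def u_def l_def)
      then have "Clause a ?b \<in> ground_program"
        unfolding a by (rule par_star_overruled_instance)
      then have "(\<exists>k\<in>set ?b. complement k \<in> J) \<or> (\<exists>d\<in>A. Pos d \<in> set ?b)"
        using Neg.hyps(1) \<open>a \<in> A\<close> unfolding unfounded_def by fastforce
      moreover have pos: "Pos (Atom m_neg [rep_lit q, x']) \<in> W" "Pos (Atom m_rule [l, x', u]) \<in> W"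
        "Pos (Atom m_loop_lambda [u]) \<in> W"
        using neg_holds[OF q] rule_holds[OF s(1)] s(2) lam
          loop_lambda_iff(1)[of "ante s"] ground_rule_literals(2)[OF D s(1)]
        by (auto simp: x'_def u_def l_def antecedent_def)
      moreover have "Neg d \<in> W" if "d \<in> A" for d
        using Neg that by blast
      moreover have "J \<subseteq> W"
        using Neg by blast
      \<comment> \<open>Only the negative literal can block the clause, as the positive ones are
        true. Truth in \<open>W\<close> is enough here, because \<open>par_star_defeats_iff\<close>
        evaluates the atom without the induction hypothesis.\<close>
      ultimately have "Pos (Atom m_defeats [rep_label (label r), l]) \<in> W"
        using pos[THEN wf_model_not_both] by auto
      then show "(label r, label s) \<in> superior D"
        using ground_rule_meta[OF r] ground_rule_meta[OF s(1)]
        by (simp add: l_def par_star_defeats_iff)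
    qed
  qed
  then show ?case
    by (cases a) auto
qed

lemma par_star_correct:
  "q \<in> P_par_star \<Sigma> D \<longleftrightarrow> wf_entails (meta_universe \<Sigma> D) (metaprogram_par_star D)
     (Pos (Atom m_defeasibly [rep_lit q]))"
  using par_star_complete[of q] wf_model_par_star_sound[of "Pos (Atom m_defeasibly [rep_lit q])"]
  by (auto simp: wf_entails_def)

end

theorem theorem5:
  fixes \<Sigma> :: "('f \<times> nat) set"
    and D :: "('p, 'f, 'v, 'l) dtheory"
    and q :: "('p, 'f, 'v) atom literal"
  assumes "defeasible_theory \<Sigma> D"
    and "q \<in> ground_literals \<Sigma> D"
  shows "(proves_par \<Sigma> D q \<longleftrightarrow>
            wf_entails (meta_universe \<Sigma> D) (metaprogram_par D)
              (Pos (Atom m_defeasibly [rep_lit q]))) \<and>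
         (proves_par_star \<Sigma> D q \<longleftrightarrow>
            wf_entails (meta_universe \<Sigma> D) (metaprogram_par_star D)
              (Pos (Atom m_defeasibly [rep_lit q])))"
  using assms(1) by (simp add: proves_par_def proves_par_star_def par_correct par_star_correct)

end
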